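(* Every planar graph $G$ is equitable list point $k$-arborable for every integer $k\geq \max\{\lceil (\Delta(G)+1)/2\rceil,5\}$, where $\Delta(G)$ is the maximum degree of $G$.
   Context: All graphs are finite, simple and undirected. A $k$-list assignment of a graph $G$ assigns to each vertex $v$ a set (list) $L(v)$ of $k$ colors. A graph $G$ is equitable list point $k$-arborable if for every $k$-list assignment $L$ one can choose $c(v)\in L(v)$ for each vertex $v$ such that each color class induces an acyclic subgraph (a forest) of $G$ and each color appears on at most $\lceil |V(G)|/k\rceil$ vertices of $G$. *)

theory Defs
  imports "HOL-Analysis.Analysis" "Graph_Theory.Graph_Theory"
begin

text \<open>
  A finite simple undirected graph is an instance of the locale predicate \<^const>\<open>graph\<close>: a finite
  symmetric digraph without loops and parallel arcs, so that every undirected edge \<open>uv\<close>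
  is represented by the two opposite arcs from \<open>u\<close> to \<open>v\<close> and from \<open>v\<close> to \<open>u\<close>.
\<close>

definition undirected_edges :: "('a, 'b) pre_digraph \<Rightarrow> 'a set set" where
  "undirected_edges G = {{u, v} | u v. u \<rightarrow>\<^bsub>G\<^esub> v}"

text \<open>
  In a symmetric digraph \<^const>\<open>out_degree\<close> is the number of undirected edges at a vertex.
  The inserted \<open>0\<close> only matters for the graph without vertices.
\<close>

definition max_degree :: "('a, 'b) pre_digraph \<Rightarrow> nat" where
  "max_degree G = Max (insert 0 (out_degree G ` verts G))"

text \<open>
  The library predicate \<^const>\<open>forest\<close> is not the undirected notion: it counts traversing one edge
  back and forth as a (directed) cycle of length 2. The cycles of a simple undirected graph are
  the directed cycles of length at least 3 of its symmetric digraph.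
\<close>

definition undirected_acyclic :: "('a, 'b) pre_digraph \<Rightarrow> bool" where
  "undirected_acyclic G \<longleftrightarrow> \<not> (\<exists>p. pre_digraph.cycle G p \<and> 3 \<le> length p)"

text \<open>
  Crossing-free drawings in the plane, with \<^typ>\<open>complex\<close> as the Euclidean plane: distinct
  vertices are distinct points, each edge is a simple arc joining its two ends, and the interior
  of an edge contains no vertex and no point of any other edge.
\<close>

definition plane_drawing ::
    "('a, 'b) pre_digraph \<Rightarrow> ('a \<Rightarrow> complex) \<Rightarrow> ('a set \<Rightarrow> real \<Rightarrow> complex) \<Rightarrow> bool" where
  "plane_drawing G \<phi> \<gamma> \<longleftrightarrow>
     inj_on \<phi> (verts G) \<and>
     (\<forall>e \<in> undirected_edges G.
        arc (\<gamma> e) \<and> {pathstart (\<gamma> e), pathfinish (\<gamma> e)} = \<phi> ` e \<and>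
        (path_image (\<gamma> e) - \<phi> ` e) \<inter> \<phi> ` verts G = {} \<and>
        (\<forall>e' \<in> undirected_edges G. e' \<noteq> e \<longrightarrow>
           (path_image (\<gamma> e) - \<phi> ` e) \<inter> path_image (\<gamma> e') = {}))"

definition planar_graph :: "('a, 'b) pre_digraph \<Rightarrow> bool" where
  "planar_graph G \<longleftrightarrow> (\<exists>\<phi> \<gamma>. plane_drawing G \<phi> \<gamma>)"

definition list_assignment :: "('a, 'b) pre_digraph \<Rightarrow> nat \<Rightarrow> ('a \<Rightarrow> 'c set) \<Rightarrow> bool" where
  "list_assignment G k L \<longleftrightarrow> (\<forall>v \<in> verts G. finite (L v) \<and> card (L v) = k)"

text \<open>The type argument is the (arbitrary) type the colours are taken from.\<close>

definition equitable_list_point_arborable ::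
    "'c itself \<Rightarrow> ('a, 'b) pre_digraph \<Rightarrow> nat \<Rightarrow> bool" where
  "equitable_list_point_arborable (_ :: 'c itself) G k \<longleftrightarrow>
     (\<forall>L :: 'a \<Rightarrow> 'c set. list_assignment G k L \<longrightarrow>
        (\<exists>c. (\<forall>v \<in> verts G. c v \<in> L v) \<and>
             (\<forall>x. undirected_acyclic (G \<restriction> {v \<in> verts G. c v = x}) \<and>
                  int (card {v \<in> verts G. c v = x}) \<le> \<lceil>real (card (verts G)) / real k\<rceil>)))"

end

theory Submission
  imports Defs "HOL-Library.Transitive_Closure_Table"
begin

text \<open>
  Colour greedily from a set \<open>S\<close> of \<open>k\<close> vertices: given a colouring of \<open>G - S\<close>, the vertices
  \<open>x\<^sub>k, \<dots>, x\<^sub>1\<close> of \<open>S\<close> can be given distinct colours, each occurring at most once on the neighbours of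
  its vertex outside \<open>S\<close>, provided that \<open>x\<^sub>i\<close> has at most \<open>2i - 1\<close> neighbours outside \<open>S\<close>. Then no
  colour class acquires a cycle and every class grows by at most one.

  The set \<open>S\<close> is found by discharging. Euler's formula enters in the following form: a plane graph
  has a set \<open>T\<close> of triangles (its triangular faces) such that every edge lies in at most two of them
  and \<open>|T| \<ge> 2|E| - 4|V| + 6\<close>. This is proved without faces, by induction on the number of edges,
  from the Jordan curve theorem: a cycle splits the graph into an inner and an outer part, the outer
  one is turned inside out by an inversion, and a path through a disc splits it by the theta curve
  theorem. Giving each vertex the charge \<open>deg - 4\<close>, the total charge is less than \<open>|T|\<close>; but if no
  suitable \<open>S\<close> exists, the vertices can pay 1 to every triangle of \<open>T\<close>. Indices \<open>i \<ge> 3\<close> not needed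
  for the local configuration are filled by 5-degeneracy.
\<close>

section \<open>Simple graphs\<close>

definition neighbours :: "'a set set \<Rightarrow> 'a \<Rightarrow> 'a set" where
  "neighbours E x = {y. {x, y} \<in> E}"

definition induced_edges :: "'a set set \<Rightarrow> 'a set \<Rightarrow> 'a set set" where
  "induced_edges E W = {e \<in> E. e \<subseteq> W}"

definition degenerate :: "'a set set \<Rightarrow> nat \<Rightarrow> 'a set \<Rightarrow> bool" where
  "degenerate E d X \<longleftrightarrow> (\<forall>A \<subseteq> X. A \<noteq> {} \<longrightarrow> (\<exists>x \<in> A. card (neighbours E x \<inter> A) \<le> d))"

lemma neighbours_sym: "y \<in> neighbours E x \<longleftrightarrow> x \<in> neighbours E y"
  by (simp add: neighbours_def insert_commute)

lemma neighbours_induced_edges: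
  "x \<in> W \<Longrightarrow> neighbours (induced_edges E W) x = neighbours E x \<inter> W"
  by (auto simp: neighbours_def induced_edges_def)

locale simple_graph =
  fixes V :: "'a set" and E :: "'a set set"
  assumes finite_V: "finite V"
    and edge: "e \<in> E \<Longrightarrow> e \<subseteq> V \<and> card e = 2"
begin

abbreviation nbr :: "'a \<Rightarrow> 'a set" where "nbr \<equiv> neighbours E"

abbreviation deg :: "'a \<Rightarrow> nat" where "deg x \<equiv> card (nbr x)"

lemma finite_E: "finite E"
  by (rule finite_subset[of _ "Pow V"]) (use edge finite_V in auto)

lemma Union_E_subset: "\<Union> E \<subseteq> V"
  using edge by auto

lemma simple_graph_subset:
  assumes "V' \<subseteq> V" "E' \<subseteq> E" "\<Union> E' \<subseteq> V'"
  shows "simple_graph V' E'"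
proof
  show "finite V'" using assms(1) finite_V finite_subset by blast
  show "e \<subseteq> V' \<and> card e = 2" if "e \<in> E'" for e using assms edge that by blast
qed

lemma edge_endpoints:
  assumes "e \<in> E" "x \<in> e"
  obtains y where "e = {x, y}" "x \<noteq> y"
proof -
  obtain p q where "e = {p, q}" "p \<noteq> q" using edge[OF assms(1)] by (auto simp: card_2_iff)
  then show ?thesis using assms(2) that by (auto simp: insert_commute)
qed

lemma nbrD: "y \<in> nbr x \<Longrightarrow> x \<in> V \<and> y \<in> V \<and> x \<noteq> y"
  using edge[of "{x, y}"] by (auto simp: neighbours_def)

lemma nbr_subset: "nbr x \<subseteq> V"
  using nbrD by auto

lemma finite_nbr [simp]: "finite (nbr x)"
  using finite_subset[OF nbr_subset finite_V] .

lemma ex_nbr_notin: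
  assumes "card A < deg x" "finite A"
  obtains y where "y \<in> nbr x" "y \<notin> A"
  using assms card_mono[of A "nbr x"] by fastforce

lemma card_nbr_Diff_le:
  assumes "A \<subseteq> nbr x" "A \<subseteq> C"
  shows "card (nbr x - C) + card A \<le> deg x"
proof -
  have "card (nbr x - C) + card A = card ((nbr x - C) \<union> A)"
    using assms finite_subset[OF assms(1)] by (subst card_Un_disjoint) auto
  also have "\<dots> \<le> deg x" using assms by (intro card_mono) auto
  finally show ?thesis .
qed

lemma deg_eq_card_incident_edges: "deg x = card {e \<in> E. x \<in> e}"
proof (rule bij_betw_same_card)
  show "bij_betw (\<lambda>y. {x, y}) (nbr x) {e \<in> E. x \<in> e}"
    unfolding bij_betw_def
  proof
    have "e \<in> (\<lambda>y. {x, y}) ` nbr x" if e: "e \<in> E" "x \<in> e" for e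
    proof -
      obtain y where "e = {x, y}" using edge_endpoints[OF e] by blast
      then show ?thesis using e(1) by (simp add: neighbours_def)
    qed
    then show "(\<lambda>y. {x, y}) ` nbr x = {e \<in> E. x \<in> e}" by (auto simp: neighbours_def)
  qed (auto simp: inj_on_def doubleton_eq_iff)
qed

lemma sum_deg: "(\<Sum>x\<in>V. deg x) = 2 * card E"
proof -
  have "card {x \<in> V. x \<in> e} = 2" if "e \<in> E" for e
    using edge[OF that] by (metis Int_absorb1 Int_def)
  then show ?thesis
    unfolding deg_eq_card_incident_edges by (intro sum_multicount finite_V finite_E) auto
qed

lemma sum_card_nbr_Int:
  assumes "X \<subseteq> V"
  shows "(\<Sum>x \<in> V - X. card (nbr x \<inter> X)) = (\<Sum>y \<in> X. card (nbr y - X))"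
proof -
  have "{x \<in> V - X. y \<in> nbr x} = nbr y - X" for y
    using nbr_subset neighbours_sym by fast
  then have "(\<Sum>x \<in> V - X. card {y \<in> X. y \<in> nbr x}) = (\<Sum>y \<in> X. card (nbr y - X))"
    using finite_V finite_subset[OF assms] by (intro sum_multicount_gen) auto
  moreover have "{y \<in> X. y \<in> nbr x} = nbr x \<inter> X" for x by auto
  ultimately show ?thesis by simp
qed

lemma degenerate_insert:
  assumes "card (nbr v \<inter> X) \<le> d" "degenerate E d X" "finite X"
  shows "degenerate E d (insert v X)"
  unfolding degenerate_def
proof (intro allI impI)
  fix A assume A_subset: "A \<subseteq> insert v X" "A \<noteq> {}"
  show "\<exists>x \<in> A. card (nbr x \<inter> A) \<le> d"
  proof (cases "v \<in> A")
    case True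
    have "nbr v \<inter> A \<subseteq> nbr v \<inter> X" using A_subset nbrD by auto
    then have "card (nbr v \<inter> A) \<le> card (nbr v \<inter> X)" by (intro card_mono) auto
    then show ?thesis using True assms(1) by (meson le_trans)
  next
    case False
    then show ?thesis using A_subset assms(2) by (auto simp: degenerate_def)
  qed
qed

end

section \<open>Triangles\<close>

definition triangles :: "'a set set \<Rightarrow> 'a set set" where
  "triangles E = {t. card t = 3 \<and> (\<forall>x\<in>t. \<forall>y\<in>t. x \<noteq> y \<longrightarrow> {x, y} \<in> E)}"

lemma triangles_Int: "triangles (E \<inter> F) = triangles E \<inter> triangles F"
  by (auto simp: triangles_def)

lemma triangles_mono: "E \<subseteq> F \<Longrightarrow> triangles E \<subseteq> triangles F"
  by (auto simp: triangles_def)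

lemma insert_in_triangles_iff:
  "{x, y, z} \<in> triangles E \<longleftrightarrow>
     x \<noteq> y \<and> x \<noteq> z \<and> y \<noteq> z \<and> {x, y} \<in> E \<and> {x, z} \<in> E \<and> {y, z} \<in> E"
  by (auto simp: triangles_def card_insert_if insert_commute)

lemma triangle_through_edge:
  assumes "t \<in> triangles E" "x \<in> t" "y \<in> t" "x \<noteq> y"
  obtains z where "t = {x, y, z}"
proof -
  have "card (t - {x, y}) = 1" using assms by (subst card_Diff_subset) (auto simp: triangles_def)
  then obtain z where "t - {x, y} = {z}" by (auto simp: card_1_singleton_iff)
  then show ?thesis using that[of z] assms by auto
qed

lemma triangle_through_vertex:
  assumes "t \<in> triangles E" "x \<in> t"
  obtains y z where "t = {x, y, z}"
proof -
  have "t \<noteq> {x}" using assms by (auto simp: triangles_def)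
  then obtain y where "y \<in> t" "x \<noteq> y" using assms by auto
  then show ?thesis using triangle_through_edge[OF assms] that by blast
qed

lemma in_edges_if_subset_triangle:
  assumes "t \<in> triangles E" "card e = 2" "e \<subseteq> t"
  shows "e \<in> E"
  using assms by (auto simp: triangles_def card_2_iff)

lemma triangle_subset_Union:
  assumes "t \<in> triangles E"
  shows "t \<subseteq> \<Union> E"
proof
  fix x assume "x \<in> t"
  then obtain y z where "t = {x, y, z}" using triangle_through_vertex[OF assms] by blast
  then show "x \<in> \<Union> E" using assms by (auto simp: insert_in_triangles_iff)
qed

lemma finite_triangles: "finite (\<Union> E) \<Longrightarrow> finite (triangles E)"
  using triangle_subset_Union by (metis Pow_iff finite_Pow_iff finite_subset subsetI)

section \<open>Walks and cycles as vertex lists\<close>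

fun walk_edges :: "'a list \<Rightarrow> 'a set set" where
  "walk_edges (x # y # zs) = insert {x, y} (walk_edges (y # zs))"
| "walk_edges _ = {}"

definition cycle_edges :: "'a list \<Rightarrow> 'a set set" where
  "cycle_edges cs = walk_edges (cs @ [hd cs])"

definition is_cycle :: "'a set set \<Rightarrow> 'a list \<Rightarrow> bool" where
  "is_cycle E cs \<longleftrightarrow> distinct cs \<and> 3 \<le> length cs \<and> cycle_edges cs \<subseteq> E"

lemma walk_edges_append:
  "walk_edges (xs @ a # ys) = walk_edges (xs @ [a]) \<union> walk_edges (a # ys)"
  by (induction xs rule: walk_edges.induct) auto

lemma walk_edges_rev: "walk_edges (rev xs) = walk_edges xs"
proof (induction xs rule: walk_edges.induct)
  case (1 x y zs)
  have "walk_edges (rev zs @ [y, x]) = walk_edges (rev zs @ [y]) \<union> walk_edges [y, x]"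
    by (rule walk_edges_append)
  with 1 show ?case by (simp add: insert_commute)
qed auto

lemma walk_edges_subset: "e \<in> walk_edges xs \<Longrightarrow> e \<subseteq> set xs"
  by (induction xs rule: walk_edges.induct) auto

lemma finite_walk_edges [simp]: "finite (walk_edges xs)"
  by (induction xs rule: walk_edges.induct) auto

lemma notin_walk_edges: "x \<notin> set xs \<Longrightarrow> {x, y} \<notin> walk_edges xs"
  using walk_edges_subset by fastforce

lemma card_walk_edges: "distinct xs \<Longrightarrow> card (walk_edges xs) = length xs - 1"
proof (induction xs rule: walk_edges.induct)
  case (1 x y zs)
  then have "{x, y} \<notin> walk_edges (y # zs)" by (simp add: notin_walk_edges)
  with 1 show ?case by simp
qed auto

lemma Union_walk_edges: "2 \<le> length xs \<Longrightarrow> \<Union> (walk_edges xs) = set xs"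
proof (induction xs rule: walk_edges.induct)
  case (1 x y zs)
  then show ?case by (cases zs) auto
qed auto

lemma triangles_walk_edges: "distinct xs \<Longrightarrow> triangles (walk_edges xs) = {}"
proof (induction xs rule: walk_edges.induct)
  case (1 x y zs)
  have only_nbr: "b = y" if "{x, b} \<in> walk_edges (x # y # zs)" for b
    using that 1(2) notin_walk_edges[of x "y # zs" b] by (auto simp: doubleton_eq_iff)
  have False if t: "t \<in> triangles (walk_edges (x # y # zs))" for t
  proof -
    have "x \<notin> t"
    proof
      assume "x \<in> t"
      then obtain b c where "t = {x, b, c}" using triangle_through_vertex[OF t] by blast
      then show False using t only_nbr[of b] only_nbr[of c] by (simp add: insert_in_triangles_iff)
    qed
    then have "t \<in> triangles (walk_edges (y # zs))"
      using t by (auto simp: triangles_def doubleton_eq_iff)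
    then show False using 1 by simp
  qed
  then show ?case by blast
qed (auto simp: triangles_def card_Suc_eq numeral_3_eq_3)

lemma triangles_empty [simp]: "triangles {} = {}"
  using triangles_walk_edges[of "[]"] by simp

lemma walk_edges_meet_inner:
  "m \<noteq> [] \<Longrightarrow> e \<in> walk_edges (a # m @ [b]) \<Longrightarrow> e \<inter> set m \<noteq> {}"
proof (induction m arbitrary: a)
  case (Cons x m)
  then show ?case by (cases m) auto
qed simp

lemma cycle_edges_split:
  "cycle_edges (a # xs @ b # ys) = walk_edges (a # xs @ [b]) \<union> walk_edges (b # ys @ [a])"
  using walk_edges_append[of "a # xs" b "ys @ [a]"] by (simp add: cycle_edges_def)

lemma cycle_edges_snoc:
  assumes "xs \<noteq> []"
  shows "cycle_edges (xs @ [b]) = insert {b, hd xs} (walk_edges (xs @ [b]))"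
  using assms walk_edges_append[of xs b "[hd xs]"] by (auto simp: cycle_edges_def)

lemma cycle_edges_append_commute: "cycle_edges (xs @ ys) = cycle_edges (ys @ xs)"
proof (cases xs; cases ys)
  fix a xs' b ys' assume "xs = a # xs'" "ys = b # ys'"
  then show ?thesis
    using cycle_edges_split[of a xs' b ys'] cycle_edges_split[of b ys' a xs'] by auto
qed auto

lemma finite_cycle_edges [simp]: "finite (cycle_edges cs)"
  by (simp add: cycle_edges_def)

lemma Union_cycle_edges: "cs \<noteq> [] \<Longrightarrow> \<Union> (cycle_edges cs) = set cs"
  using Union_walk_edges[of "cs @ [hd cs]"] by (cases cs) (auto simp: cycle_edges_def)

lemma cycle_edges_subset: "e \<in> cycle_edges cs \<Longrightarrow> e \<subseteq> set cs"
  using walk_edges_subset[of e "cs @ [hd cs]"] by (cases cs) (auto simp: cycle_edges_def)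

lemma card_cycle_edges:
  assumes "distinct cs" "3 \<le> length cs"
  shows "card (cycle_edges cs) = length cs"
proof -
  obtain x y ys z where cs: "cs = x # (y # ys) @ [z]"
    using assms(2) by (cases cs; cases "tl cs"; cases "tl (tl cs)" rule: rev_cases) auto
  have "{x, z} \<notin> walk_edges (x # y # ys @ [z])"
    using assms(1) notin_walk_edges[of x "y # ys @ [z]"] by (auto simp: cs doubleton_eq_iff)
  then have "{z, x} \<notin> walk_edges cs" by (simp add: cs insert_commute)
  moreover have "cycle_edges cs = insert {z, x} (walk_edges cs)"
    using cycle_edges_snoc[of "x # y # ys" z] by (simp add: cs)
  ultimately show ?thesis using card_walk_edges[OF assms(1)] assms(2) by simp
qed

lemma cycle_edges_split_disjoint:
  assumes "distinct (a # xs @ b # ys)" "3 \<le> length (a # xs @ b # ys)"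
  shows "walk_edges (a # xs @ [b]) \<inter> walk_edges (b # ys @ [a]) = {}"
proof -
  have "card (walk_edges (a # xs @ [b])) + card (walk_edges (b # ys @ [a]))
      = card (cycle_edges (a # xs @ b # ys))"
    using assms card_cycle_edges[OF assms]
    by (subst (1 2) card_walk_edges) auto
  then have "card (walk_edges (a # xs @ [b]) \<inter> walk_edges (b # ys @ [a])) = 0"
    unfolding cycle_edges_split
    using card_Un_Int[of "walk_edges (a # xs @ [b])" "walk_edges (b # ys @ [a])"] by simp
  then show ?thesis by simp
qed

lemma triangles_cycle_edges:
  assumes "distinct cs" "3 \<le> length cs"
  shows "triangles (cycle_edges cs) \<subseteq> {set cs}"
proof
  fix t assume t_triangle: "t \<in> triangles (cycle_edges cs)"
  have "a \<in> t" if "a \<in> set cs" for a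
  proof (rule ccontr)
    assume a_notin: "a \<notin> t"
    obtain l r where lr: "cs = l @ a # r" using \<open>a \<in> set cs\<close> by (meson split_list)
    define xs where "xs = r @ l"
    have "cycle_edges cs = cycle_edges (xs @ [a])"
      using cycle_edges_append_commute[of "l @ [a]" r] by (simp add: lr xs_def)
    also have "\<dots> = insert {a, hd xs} (walk_edges (xs @ [a]))"
      using assms(2) by (intro cycle_edges_snoc) (auto simp: lr xs_def)
    finally have "t \<in> triangles (walk_edges (xs @ [a]))"
      using t_triangle a_notin by (auto simp: triangles_def doubleton_eq_iff)
    moreover have "distinct (xs @ [a])" using assms(1) by (auto simp: lr xs_def)
    ultimately show False using triangles_walk_edges by blast
  qed
  moreover have "t \<subseteq> set cs"
    using triangle_subset_Union[OF t_triangle] assms(2) Union_cycle_edges[of cs] by fastforce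
  ultimately show "t \<in> {set cs}" by auto
qed

lemma (in simple_graph) cycle_subset_V: "is_cycle E cs \<Longrightarrow> set cs \<subseteq> V"
  using Union_cycle_edges[of cs] edge by (fastforce simp: is_cycle_def)

lemma (in simple_graph) two_nbrs_on_cycle:
  assumes cycle: "is_cycle E cs" and v_on_cycle: "v \<in> set cs"
  shows "2 \<le> card (nbr v \<inter> set cs)"
proof -
  obtain l r where lr: "cs = l @ v # r" using v_on_cycle by (meson split_list)
  define xs where "xs = r @ l"
  have xs: "distinct xs" "2 \<le> length xs" "set xs \<subseteq> set cs"
    using cycle by (auto simp: is_cycle_def lr xs_def)
  then obtain y zs z where yz: "xs = y # zs @ [z]"
    by (cases xs; cases "tl xs" rule: rev_cases) auto
  have "cycle_edges cs = cycle_edges (v # xs)"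
    using cycle_edges_append_commute[of l "v # r"] by (simp add: lr xs_def)
  also have "\<dots> = insert {v, y} (walk_edges (y # zs @ [z]) \<union> walk_edges [z, v])"
    using walk_edges_append[of "v # y # zs" z "[v]"] by (auto simp: cycle_edges_def yz)
  finally have "{v, y} \<in> E" "{z, v} \<in> E" using cycle by (auto simp: is_cycle_def)
  then have "{y, z} \<subseteq> nbr v \<inter> set cs"
    using xs(3) by (auto simp: neighbours_def insert_commute yz)
  then have "card {y, z} \<le> card (nbr v \<inter> set cs)" by (intro card_mono) auto
  then show ?thesis using xs(1) yz by simp
qed

lemma (in simple_graph) no_cycle_if_degenerate_1:
  assumes X_subset: "X \<subseteq> V" and degenerate: "degenerate E 1 X"
  shows "\<not> is_cycle (induced_edges E X) cs"
proof
  interpret X: simple_graph X "induced_edges E X"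
    using X_subset by (intro simple_graph_subset) (auto simp: induced_edges_def)
  assume cycle: "is_cycle (induced_edges E X) cs"
  have cs: "set cs \<subseteq> X" "set cs \<noteq> {}"
    using X.cycle_subset_V[OF cycle] cycle by (auto simp: is_cycle_def)
  then obtain a where low_a: "a \<in> set cs" "card (nbr a \<inter> set cs) \<le> 1"
    using degenerate unfolding degenerate_def by blast
  have "X.nbr a \<inter> set cs = nbr a \<inter> set cs"
    using low_a(1) cs(1) by (auto simp: neighbours_induced_edges subset_iff)
  then show False using X.two_nbrs_on_cycle[OF cycle low_a(1)] low_a(2) by simp
qed

lemma (in simple_graph) cycle_if_min_deg:
  assumes "V \<noteq> {}" and deg: "\<And>v. v \<in> V \<Longrightarrow> 2 \<le> deg v"
  obtains cs where "is_cycle E cs"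
proof -
  define path where
    "path xs \<longleftrightarrow> xs \<noteq> [] \<and> distinct xs \<and> set xs \<subseteq> V \<and> walk_edges xs \<subseteq> E" for xs
  obtain v where "v \<in> V" using assms by auto
  then have "path [v]" by (simp add: path_def)
  moreover have "\<forall>ys. path ys \<longrightarrow> length ys < Suc (card V)"
    by (metis path_def finite_V card_mono distinct_card less_Suc_eq_le)
  ultimately obtain xs
    where xs_path: "path xs" and longest: "\<And>ys. path ys \<Longrightarrow> length ys \<le> length xs"
    using ex_has_greatest_nat[of path "[v]" length] by blast
  obtain x xr where xs_eq: "xs = x # xr" using xs_path by (cases xs) (auto simp: path_def)
  have nbr_x: "nbr x \<subseteq> set xr"
  proof
    fix y assume y_nbr: "y \<in> nbr x"
    show "y \<in> set xr"
    proof (rule ccontr)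
      assume "y \<notin> set xr"
      then have "path (y # xs)"
        using xs_path nbrD[OF y_nbr] y_nbr
        by (auto simp: xs_eq path_def neighbours_def insert_commute)
      from longest[OF this] show False by simp
    qed
  qed
  have "card {hd xr} < deg x" using deg[of x] xs_path by (simp add: xs_eq path_def)
  then obtain y where y_nbr: "y \<in> nbr x" "y \<noteq> hd xr" by (rule ex_nbr_notin) auto
  then obtain l r where lr: "xr = l @ y # r" using nbr_x by (meson split_list subsetD)
  with y_nbr have "l \<noteq> []" by auto
  have "walk_edges (x # l @ [y]) \<subseteq> E"
    using xs_path walk_edges_append[of "x # l" y r] by (auto simp: xs_eq lr path_def)
  then have "cycle_edges ((x # l) @ [y]) \<subseteq> E"
    using y_nbr(1) by (subst cycle_edges_snoc) (auto simp: neighbours_def insert_commute)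
  then have "is_cycle E (x # l @ [y])"
    using xs_path \<open>l \<noteq> []\<close> by (auto simp: is_cycle_def xs_eq lr path_def Suc_le_eq numeral_3_eq_3)
  then show ?thesis by (rule that)
qed

section \<open>Components outside a vertex set\<close>

definition adjacent_outside :: "'a set set \<Rightarrow> 'a set \<Rightarrow> 'a \<Rightarrow> 'a \<Rightarrow> bool" where
  "adjacent_outside E S u v \<longleftrightarrow> {u, v} \<in> E \<and> u \<notin> S \<and> v \<notin> S"

definition component_outside :: "'a set set \<Rightarrow> 'a set \<Rightarrow> 'a \<Rightarrow> 'a set" where
  "component_outside E S x = {y. (adjacent_outside E S)\<^sup>*\<^sup>* x y}"

lemma in_component_outside_self: "x \<in> component_outside E S x"
  by (simp add: component_outside_def)

lemma component_outside_disjoint: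
  assumes "x \<notin> S" "k \<in> component_outside E S x"
  shows "k \<notin> S"
proof -
  have "(adjacent_outside E S)\<^sup>*\<^sup>* x k" using assms(2) by (simp add: component_outside_def)
  then show ?thesis using assms(1) by cases (auto simp: adjacent_outside_def)
qed

lemma component_outside_closed:
  assumes "x \<notin> S" "k \<in> component_outside E S x" "{k, v} \<in> E" "v \<notin> S"
  shows "v \<in> component_outside E S x"
proof -
  have "adjacent_outside E S k v"
    using assms component_outside_disjoint[of x S k E] by (simp add: adjacent_outside_def)
  then show ?thesis using assms(2) by (auto simp: component_outside_def)
qed

lemma (in simple_graph) component_outside_subset_V:
  assumes "x \<in> V" shows "component_outside E S x \<subseteq> V"
proof
  fix k assume "k \<in> component_outside E S x"
  then have "(adjacent_outside E S)\<^sup>*\<^sup>* x k" by (simp add: component_outside_def)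
  then show "k \<in> V" by cases (use assms edge in \<open>auto simp: adjacent_outside_def\<close>)
qed

lemma walk_edges_rtrancl_path:
  assumes "rtrancl_path (adjacent_outside E S) x xs y"
  shows "last (x # xs) = y \<and> walk_edges (x # xs) \<subseteq> E \<and> set xs \<subseteq> component_outside E S x"
  using assms
proof (induction rule: rtrancl_path.induct)
  case (step x y ys z)
  then have "component_outside E S y \<subseteq> component_outside E S x"
    by (auto simp: component_outside_def intro: converse_rtranclp_into_rtranclp)
  then show ?case
    using step in_component_outside_self[of y E S] by (auto simp: adjacent_outside_def)
qed auto

lemma component_outside_path:
  assumes k_in: "k \<in> component_outside E S x" and k'_in: "k' \<in> component_outside E S x"
  obtains m where "m \<noteq> []" "distinct m" "hd m = k" "last m = k'"
    "set m \<subseteq> component_outside E S x" "walk_edges m \<subseteq> E"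
proof -
  let ?R = "(adjacent_outside E S)\<^sup>*\<^sup>*"
  have "symp ?R"
    by (rule symp_rtranclp) (auto simp: symp_def adjacent_outside_def insert_commute)
  then have "?R k k'"
    using k_in k'_in
    unfolding component_outside_def by (metis mem_Collect_eq rtranclp_trans sympD)
  then obtain xs where xs_path: "rtrancl_path (adjacent_outside E S) k xs k'" "distinct (k # xs)"
    by (metis rtranclp_eq_rtrancl_path rtrancl_path_distinct)
  have "component_outside E S k \<subseteq> component_outside E S x"
    using k_in by (auto simp: component_outside_def)
  then show ?thesis
    using that[of "k # xs"] xs_path walk_edges_rtrancl_path[OF xs_path(1)] k_in by auto
qed

lemma path_through_component_outside:
  assumes x_notin: "x \<notin> S" and ab_in_S: "a \<in> S" "b \<in> S" "a \<noteq> b"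
    and a_attached: "neighbours E a \<inter> component_outside E S x \<noteq> {}"
    and b_attached: "neighbours E b \<inter> component_outside E S x \<noteq> {}"
  obtains m where "m \<noteq> []" "distinct (a # m @ [b])" "set m \<inter> S = {}"
    "walk_edges (a # m @ [b]) \<subseteq> E"
proof -
  obtain k k' where k_adjacent: "k \<in> component_outside E S x" "{a, k} \<in> E"
    and k'_adjacent: "k' \<in> component_outside E S x" "{b, k'} \<in> E"
    using a_attached b_attached by (auto simp: neighbours_def)
  obtain m where m_path: "m \<noteq> []" "distinct m" "hd m = k" "last m = k'"
    "set m \<subseteq> component_outside E S x" "walk_edges m \<subseteq> E"
    by (rule component_outside_path[OF k_adjacent(1) k'_adjacent(1)])
  have disj: "set m \<inter> S = {}" using m_path(5) component_outside_disjoint[OF x_notin] by blast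
  obtain ys zs where m_eq: "m = k # ys" "m = zs @ [k']"
    using m_path(1,3,4) by (metis append_butlast_last_id list.collapse)
  have "walk_edges (a # m @ [b]) = insert {a, k} (walk_edges (m @ [b]))"
    by (subst m_eq(1), subst m_eq(1)) simp
  also have "walk_edges (m @ [b]) = walk_edges m \<union> {{k', b}}"
    using walk_edges_append[of zs k' "[b]"] m_eq(2) by simp
  finally have "walk_edges (a # m @ [b]) \<subseteq> E"
    using m_path(6) k_adjacent(2) k'_adjacent(2) by (auto simp: insert_commute)
  moreover have "distinct (a # m @ [b])" using m_path(2) disj ab_in_S by auto
  ultimately show ?thesis using that m_path(1) disj by blast
qed

section \<open>Insides and outsides of closed curves\<close>

lemma connected_subset_inside_or_outside:
  fixes S X :: "'a::real_normed_vector set"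
  assumes "closed S" "Topological_Spaces.connected X" "X \<inter> S = {}"
  shows "X \<subseteq> inside S \<or> X \<subseteq> outside S"
proof -
  have "X \<subseteq> inside S \<union> outside S" using assms(3) by auto
  moreover have "inside S \<inter> outside S \<inter> X = {}" by simp
  ultimately show ?thesis
    using Topological_Spaces.connectedD[OF assms(2) open_inside open_outside] assms(1) by blast
qed

locale curve_inversion =
  fixes g :: "real \<Rightarrow> complex" and p :: complex
  assumes simple: "simple_path g" and closed: "pathfinish g = pathstart g"
    and p_inside: "p \<in> inside (path_image g)"
begin

definition invert :: "complex \<Rightarrow> complex" where
  "invert z = inverse (z - p)"

abbreviation curve :: "complex set" where
  "curve \<equiv> path_image g"

abbreviation inverted_curve :: "complex set" where
  "inverted_curve \<equiv> invert ` path_image g"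

lemma p_notin: "p \<notin> curve" "p \<notin> outside curve"
  using p_inside inside_no_overlap[of curve] inside_Int_outside[of curve] by blast+

lemma inj_invert: "inj_on invert X"
  by (auto simp: inj_on_def invert_def)

lemma continuous_on_invert: "p \<notin> X \<Longrightarrow> continuous_on X invert"
  unfolding invert_def by (intro continuous_intros) auto

lemma
  shows inverted_inside_nonempty: "inside inverted_curve \<noteq> {}"
    and open_inverted_inside: "open (inside inverted_curve)"
    and bounded_inverted_inside: "bounded (inside inverted_curve)"
    and closed_inverted_curve: "closed inverted_curve"
proof -
  have "simple_path (invert \<circ> g)"
    using simple continuous_on_invert[OF p_notin(1)] inj_invert
    by (rule simple_path_continuous_image)
  moreover have "pathfinish (invert \<circ> g) = pathstart (invert \<circ> g)"
    using closed by (simp add: pathfinish_compose pathstart_compose)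
  ultimately show "inside inverted_curve \<noteq> {}" "open (inside inverted_curve)"
    "bounded (inside inverted_curve)" "closed inverted_curve"
    using Jordan_inside_outside[of "invert \<circ> g"] closed_simple_path_image[of "invert \<circ> g"]
    by (simp_all add: path_image_compose)
qed

lemma invert_connected_inside_or_outside:
  assumes "Topological_Spaces.connected X" "X \<inter> curve = {}" "p \<notin> X"
  shows "invert ` X \<subseteq> inside inverted_curve \<or> invert ` X \<subseteq> outside inverted_curve"
proof (rule connected_subset_inside_or_outside[OF closed_inverted_curve])
  show "Topological_Spaces.connected (invert ` X)"
    using continuous_on_invert[OF assms(3)] assms(1) by (rule connected_continuous_image)
  show "invert ` X \<inter> inverted_curve = {}"
    using assms(2) inj_on_image_Int[OF inj_invert[of UNIV], of X curve] by simp
qed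

text \<open>Points of the inside close to \<open>p\<close> are mapped far away, hence outside the inverted curve.\<close>

lemma invert_inside_subset_outside: "invert ` (inside curve - {p}) \<subseteq> outside inverted_curve"
proof -
  note Jordan = Jordan_inside_outside[OF simple closed]
  have "filterlim invert at_infinity (at p)"
    unfolding invert_def
    by (intro filterlim_compose[OF filterlim_inverse_at_infinity]
        filterlim_atI tendsto_eq_intros refl) (auto simp: eventually_at_filter)
  moreover have "eventually (\<lambda>w. w \<notin> inside inverted_curve) at_infinity"
    using bounded_inverted_inside unfolding bounded_iff eventually_at_infinity
    by (metis linorder_not_le less_add_one order_less_le_trans)
  ultimately have "eventually (\<lambda>z. invert z \<notin> inside inverted_curve) (at p)"
    by (auto simp: filterlim_iff)
  moreover have "eventually (\<lambda>z. z \<in> inside curve - {p}) (at p)"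
    using Jordan p_inside by (auto simp: eventually_at_topological)
  ultimately have "eventually
      (\<lambda>z. invert z \<notin> inside inverted_curve \<and> z \<in> inside curve - {p}) (at p)"
    by (rule eventually_conj)
  then have "\<exists>z. invert z \<notin> inside inverted_curve \<and> z \<in> inside curve - {p}"
    by (rule eventually_happens'[OF at_neq_bot])
  moreover have "Topological_Spaces.connected (inside curve - {p})"
    using Jordan by (intro connected_open_delete) auto
  moreover have "inside curve \<inter> curve = {}" by (rule inside_no_overlap)
  ultimately show ?thesis
    using invert_connected_inside_or_outside[of "inside curve - {p}"] by blast
qed

lemma invert_outside_subset_inside: "invert ` outside curve \<subseteq> inside inverted_curve"
proof -
  note Jordan = Jordan_inside_outside[OF simple closed]
  have "\<not> invert ` outside curve \<subseteq> outside inverted_curve"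
  proof
    assume outside: "invert ` outside curve \<subseteq> outside inverted_curve"
    have "w = 0" if w_inside: "w \<in> inside inverted_curve" for w
    proof (rule ccontr)
      assume "w \<noteq> 0"
      define z where "z = p + inverse w"
      have z_eq: "invert z = w" "z \<noteq> p" using \<open>w \<noteq> 0\<close> by (simp_all add: invert_def z_def)
      have "w \<notin> inverted_curve" "w \<notin> outside inverted_curve"
        using w_inside inside_no_overlap[of inverted_curve] inside_Int_outside[of inverted_curve]
        by blast+
      then have "z \<notin> curve" "z \<notin> outside curve" "z \<notin> inside curve"
        using z_eq invert_inside_subset_outside outside by auto
      then show False using inside_Un_outside[of curve] by blast
    qed
    then have "inside inverted_curve = {0}" using inverted_inside_nonempty by blast
    then show False using open_inverted_inside by (simp add: not_open_singleton)
  qed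
  moreover have "Topological_Spaces.connected (outside curve)" "outside curve \<inter> curve = {}"
    using Jordan outside_no_overlap[of curve] by auto
  ultimately show ?thesis
    using invert_connected_inside_or_outside[of "outside curve"] p_notin(2) by blast
qed

end

section \<open>Plane drawings\<close>

locale plane_graph = simple_graph V E for V :: "'a set" and E :: "'a set set" +
  fixes \<phi> :: "'a \<Rightarrow> complex" and \<gamma> :: "'a set \<Rightarrow> real \<Rightarrow> complex"
  assumes inj: "inj_on \<phi> V"
    and arc_edge: "e \<in> E \<Longrightarrow> arc (\<gamma> e)"
    and ends_edge: "e \<in> E \<Longrightarrow> {pathstart (\<gamma> e), pathfinish (\<gamma> e)} = \<phi> ` e"
    and vertex_notin_edge: "e \<in> E \<Longrightarrow> (path_image (\<gamma> e) - \<phi> ` e) \<inter> \<phi> ` V = {}"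
    and edges_disjoint: "e \<in> E \<Longrightarrow> e' \<in> E \<Longrightarrow> e' \<noteq> e \<Longrightarrow>
      (path_image (\<gamma> e) - \<phi> ` e) \<inter> path_image (\<gamma> e') = {}"
begin

abbreviation im :: "'a set \<Rightarrow> complex set" where
  "im e \<equiv> path_image (\<gamma> e)"

abbreviation interior_edge :: "'a set \<Rightarrow> complex set" where
  "interior_edge e \<equiv> path_image (\<gamma> e) - \<phi> ` e"

abbreviation pts :: "'a set set \<Rightarrow> complex set" where
  "pts F \<equiv> \<Union> (im ` F)"

lemma plane_subgraph:
  assumes "V' \<subseteq> V" "E' \<subseteq> E" "\<Union> E' \<subseteq> V'"
  shows "plane_graph V' E' \<phi> \<gamma>"
proof -
  interpret sub: simple_graph V' E' using assms by (rule simple_graph_subset)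
  show ?thesis
  proof
    show "inj_on \<phi> V'" using inj assms(1) by (rule inj_on_subset)
    fix e assume "e \<in> E'"
    then have e_in_E: "e \<in> E" using assms by auto
    show "interior_edge e \<inter> \<phi> ` V' = {}" using vertex_notin_edge[OF e_in_E] assms by auto
    show "arc (\<gamma> e)" "{pathstart (\<gamma> e), pathfinish (\<gamma> e)} = \<phi> ` e"
      by (fact arc_edge[OF e_in_E] ends_edge[OF e_in_E])+
    fix e' assume "e' \<in> E'" "e' \<noteq> e"
    then show "interior_edge e \<inter> im e' = {}" using edges_disjoint[OF e_in_E] assms by auto
  qed
qed

lemma plane_graph_induced: "W \<subseteq> V \<Longrightarrow> plane_graph W (induced_edges E W) \<phi> \<gamma>"
  by (rule plane_subgraph) (auto simp: induced_edges_def)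

lemma plane_graph_image:
  assumes cont: "continuous_on X h" and inj_h: "inj_on h X" and in_X: "\<phi> ` V \<subseteq> X" "pts E \<subseteq> X"
  shows "plane_graph V E (h \<circ> \<phi>) (\<lambda>e. h \<circ> \<gamma> e)"
proof
  show "inj_on (h \<circ> \<phi>) V"
    using inj inj_h in_X by (auto intro: comp_inj_on inj_on_subset)
  have image: "path_image (h \<circ> \<gamma> e) = h ` im e" for e
    by (simp add: path_image_compose)
  fix e assume e_in_E: "e \<in> E"
  have im_X: "im e \<subseteq> X" using in_X e_in_E by auto
  have ends_X: "\<phi> ` e \<subseteq> X" using edge[OF e_in_E] in_X by blast
  show "arc (h \<circ> \<gamma> e)"
    using arc_edge[OF e_in_E] im_X cont inj_h
    by (auto simp: arc_def path_image_def intro!: path_continuous_image comp_inj_on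
        intro: continuous_on_subset inj_on_subset)
  show "{pathstart (h \<circ> \<gamma> e), pathfinish (h \<circ> \<gamma> e)} = (h \<circ> \<phi>) ` e"
    using arg_cong[OF ends_edge[OF e_in_E], of "image h"]
    by (simp add: pathstart_compose pathfinish_compose image_comp)
  have interior: "h ` im e - (h \<circ> \<phi>) ` e = h ` interior_edge e"
    using inj_on_image_set_diff[OF inj_h, of "im e" "\<phi> ` e"] im_X ends_X
    by (auto simp: image_comp)
  show "(path_image (h \<circ> \<gamma> e) - (h \<circ> \<phi>) ` e) \<inter> (h \<circ> \<phi>) ` V = {}"
    using vertex_notin_edge[OF e_in_E] inj_on_image_Int[OF inj_h, of "interior_edge e" "\<phi> ` V"]
      im_X in_X(1)
    unfolding image interior by (auto simp: image_comp)
  fix e' assume e'_in_E: "e' \<in> E" "e' \<noteq> e"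
  show "(path_image (h \<circ> \<gamma> e) - (h \<circ> \<phi>) ` e) \<inter> path_image (h \<circ> \<gamma> e') = {}"
    using edges_disjoint[OF e_in_E e'_in_E]
      inj_on_image_Int[OF inj_h, of "interior_edge e" "im e'"] im_X in_X(2) e'_in_E
    unfolding image interior by (auto simp: image_comp)
qed

lemma ends_in_im: "e \<in> E \<Longrightarrow> \<phi> ` e \<subseteq> im e"
  using ends_edge[of e]
  by (metis empty_subsetI insert_subset pathfinish_in_path_image pathstart_in_path_image)

lemma ends_in_pts: "F \<subseteq> E \<Longrightarrow> \<phi> ` \<Union> F \<subseteq> pts F"
  using ends_in_im by blast

lemma vertex_in_pts:
  assumes "F \<subseteq> E" "v \<in> V" "\<phi> v \<in> pts F"
  shows "v \<in> \<Union> F"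
proof -
  obtain e where e_in_F: "e \<in> F" "e \<in> E" "\<phi> v \<in> im e" using assms by auto
  then have "\<phi> v \<in> \<phi> ` e" using vertex_notin_edge[of e] assms(2) by auto
  then have "v \<in> e" using assms(2) edge[OF e_in_F(2)] inj by (meson inj_on_image_mem_iff)
  then show ?thesis using e_in_F(1) by blast
qed

lemma pts_Int:
  assumes "F \<subseteq> E" "F' \<subseteq> E" "F \<inter> F' = {}"
  shows "pts F \<inter> pts F' \<subseteq> \<phi> ` (\<Union> F \<inter> \<Union> F')"
proof
  fix z assume "z \<in> pts F \<inter> pts F'"
  then obtain e e' where e_points: "e \<in> F" "e' \<in> F'" "z \<in> im e" "z \<in> im e'" by auto
  with assms have e_edges: "e \<in> E" "e' \<in> E" "e \<noteq> e'" by auto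
  then have "z \<in> \<phi> ` e" "z \<in> \<phi> ` e'"
    using e_points edges_disjoint[of e e'] edges_disjoint[of e' e] by auto
  then have "z \<in> \<phi> ` (e \<inter> e')"
    using edge[OF e_edges(1)] edge[OF e_edges(2)] inj_on_image_Int[OF inj, of e e'] by auto
  with e_points show "z \<in> \<phi> ` (\<Union> F \<inter> \<Union> F')" by auto
qed

lemma closed_pts: "F \<subseteq> E \<Longrightarrow> closed (pts F)"
  using finite_subset[OF _ finite_E] arc_edge closed_arc_image by (intro closed_UN) blast+

lemma connected_interior_edge: "e \<in> E \<Longrightarrow> Topological_Spaces.connected (interior_edge e)"
  using connected_simple_path_endless[OF arc_imp_simple_path[OF arc_edge]] ends_edge by metis

lemma interior_edge_nonempty: "e \<in> E \<Longrightarrow> interior_edge e \<noteq> {}"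
  using nonempty_simple_path_endless[OF arc_imp_simple_path[OF arc_edge]] ends_edge by metis

lemma interior_edge_disjoint_pts: "e \<in> E \<Longrightarrow> F \<subseteq> E \<Longrightarrow> e \<notin> F \<Longrightarrow> interior_edge e \<inter> pts F = {}"
  using edges_disjoint by fastforce

lemma edge_subset_closure_interior:
  assumes "e \<in> E"
  shows "im e \<subseteq> closure (interior_edge e)"
proof -
  have simple: "simple_path (\<gamma> e)" using arc_edge[OF assms] by (rule arc_imp_simple_path)
  then have interior: "interior_edge e = \<gamma> e ` {0<..<1}"
    using simple_path_endless[OF simple] ends_edge[OF assms] by simp
  have "continuous_on {0..1} (\<gamma> e)" using simple by (simp add: simple_path_def path_def)
  then have "\<gamma> e ` closure {0<..<1} \<subseteq> closure (\<gamma> e ` {0<..<1})"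
    by (intro image_closure_subset) (auto intro: closure_subset[THEN subsetD])
  then show ?thesis unfolding interior by (simp add: path_image_def)
qed

lemma edge_arc:
  assumes "{x, y} \<in> E"
  obtains g where "arc g" "pathstart g = \<phi> x" "pathfinish g = \<phi> y" "path_image g = im {x, y}"
proof (cases "pathstart (\<gamma> {x, y}) = \<phi> x")
  case True
  then show ?thesis
    using that arc_edge[OF assms] ends_edge[OF assms] by (auto simp: doubleton_eq_iff)
next
  case False
  then show ?thesis
    using that[of "reversepath (\<gamma> {x, y})"] arc_reversepath[OF arc_edge[OF assms]]
      ends_edge[OF assms]
    by (auto simp: doubleton_eq_iff)
qed

lemma path_arc:
  assumes "distinct xs" "2 \<le> length xs" "walk_edges xs \<subseteq> E"
  shows "\<exists>g. arc g \<and> pathstart g = \<phi> (hd xs) \<and> pathfinish g = \<phi> (last xs) \<and>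
    path_image g = pts (walk_edges xs)"
  using assms
proof (induction xs rule: walk_edges.induct)
  case (1 x y zs)
  then have xy: "{x, y} \<in> E" and rest: "walk_edges (y # zs) \<subseteq> E" by auto
  obtain g where g_arc: "arc g" "pathstart g = \<phi> x" "pathfinish g = \<phi> y" "path_image g = im {x, y}"
    by (rule edge_arc[OF xy])
  show ?case
  proof (cases "zs = []")
    case True
    with g_arc show ?thesis by auto
  next
    case False
    with 1 obtain h where h_arc: "arc h" "pathstart h = \<phi> y" "pathfinish h = \<phi> (last (y # zs))"
      "path_image h = pts (walk_edges (y # zs))" by (auto simp: Suc_le_eq)
    have "{x, y} \<notin> walk_edges (y # zs)" using 1(2) by (simp add: notin_walk_edges)
    then have "im {x, y} \<inter> pts (walk_edges (y # zs)) \<subseteq> \<phi> ` ({x, y} \<inter> \<Union> (walk_edges (y # zs)))"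
      using pts_Int[of "{{x, y}}" "walk_edges (y # zs)"] xy rest by simp
    also have "{x, y} \<inter> \<Union> (walk_edges (y # zs)) \<subseteq> {y}"
      using 1(2) walk_edges_subset by fastforce
    finally have "path_image g \<inter> path_image h \<subseteq> {pathstart h}" using g_arc h_arc by auto
    then have "arc (g +++ h)" using g_arc h_arc by (simp add: arc_join)
    then show ?thesis
      using g_arc h_arc by (intro exI[of _ "g +++ h"]) (auto simp: path_image_join)
  qed
qed auto

lemma cycle_halves_Int:
  assumes cycle: "is_cycle E (a # l @ b # r)"
  shows "pts (walk_edges (a # l @ [b])) \<inter> pts (walk_edges (b # r @ [a])) = {\<phi> a, \<phi> b}"
proof
  have halves_subset: "walk_edges (a # l @ [b]) \<subseteq> E" "walk_edges (b # r @ [a]) \<subseteq> E"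
    using cycle by (auto simp: is_cycle_def cycle_edges_split)
  have Union_halves: "\<Union> (walk_edges (a # l @ [b])) = set (a # l @ [b])"
    "\<Union> (walk_edges (b # r @ [a])) = set (b # r @ [a])" by (rule Union_walk_edges; simp)+
  have "walk_edges (a # l @ [b]) \<inter> walk_edges (b # r @ [a]) = {}"
    using cycle by (intro cycle_edges_split_disjoint) (auto simp: is_cycle_def)
  from pts_Int[OF halves_subset this]
  show "pts (walk_edges (a # l @ [b])) \<inter> pts (walk_edges (b # r @ [a])) \<subseteq> {\<phi> a, \<phi> b}"
    using cycle unfolding Union_halves by (auto simp: is_cycle_def)
  show "{\<phi> a, \<phi> b} \<subseteq> pts (walk_edges (a # l @ [b])) \<inter> pts (walk_edges (b # r @ [a]))"
    using ends_in_pts[OF halves_subset(1)] ends_in_pts[OF halves_subset(2)]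
    unfolding Union_halves by auto
qed

lemma cycle_curve:
  assumes cycle: "is_cycle E cs"
  obtains g where "simple_path g" "pathfinish g = pathstart g" "path_image g = pts (cycle_edges cs)"
proof -
  obtain a b r where cs: "cs = a # [] @ b # r"
    using cycle by (cases cs; cases "tl cs") (auto simp: is_cycle_def)
  have edges: "cycle_edges cs = walk_edges (a # [] @ [b]) \<union> walk_edges (b # r @ [a])"
    unfolding cs by (rule cycle_edges_split)
  obtain g where g_arc: "arc g" "pathstart g = \<phi> a" "pathfinish g = \<phi> b"
    "path_image g = pts (walk_edges (a # [] @ [b]))"
    using path_arc[of "a # [] @ [b]"] cycle edges by (auto simp: is_cycle_def cs)
  obtain h where h_arc: "arc h" "pathstart h = \<phi> b" "pathfinish h = \<phi> a"
    "path_image h = pts (walk_edges (b # r @ [a]))"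
    using path_arc[of "b # r @ [a]"] cycle edges by (auto simp: is_cycle_def cs)
  have "path_image g \<inter> path_image h = {\<phi> a, \<phi> b}"
    unfolding g_arc(4) h_arc(4) by (rule cycle_halves_Int[OF cycle[unfolded cs]])
  then have "simple_path (g +++ h)" using g_arc h_arc by (intro simple_path_join_loop) auto
  moreover have "path_image (g +++ h) = pts (cycle_edges cs)"
    using g_arc h_arc by (simp add: path_image_join edges)
  ultimately show ?thesis using that[of "g +++ h"] g_arc h_arc by simp
qed

lemma cycle_vertex_in_pts_iff:
  assumes "is_cycle E cs" "v \<in> V"
  shows "\<phi> v \<in> pts (cycle_edges cs) \<longleftrightarrow> v \<in> set cs"
proof -
  have "\<Union> (cycle_edges cs) = set cs" "cycle_edges cs \<subseteq> E"
    using assms(1) by (auto simp: is_cycle_def intro!: Union_cycle_edges)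
  then show ?thesis
    using vertex_in_pts[of "cycle_edges cs" v] ends_in_pts[of "cycle_edges cs"] assms(2) by auto
qed

end

section \<open>Discs bounded by cycles\<close>

context plane_graph
begin

definition cycle_inside :: "'a list \<Rightarrow> complex set" where
  "cycle_inside cs = inside (pts (cycle_edges cs))"

definition cycle_outside :: "'a list \<Rightarrow> complex set" where
  "cycle_outside cs = outside (pts (cycle_edges cs))"

lemma cycle_inside_disjoint: "cycle_inside cs \<inter> pts (cycle_edges cs) = {}"
  unfolding cycle_inside_def by (rule inside_no_overlap)

lemma cycle_edge_not_inside:
  assumes "e \<in> E" "e \<in> cycle_edges cs"
  shows "\<not> interior_edge e \<subseteq> cycle_inside cs"
  using interior_edge_nonempty[OF assms(1)] assms(2) cycle_inside_disjoint[of cs] by blast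

lemma cycle_inside_Int_outside: "cycle_inside cs \<inter> cycle_outside cs = {}"
  by (simp add: cycle_inside_def cycle_outside_def)

lemma cycle_inside_Un_outside: "cycle_inside cs \<union> cycle_outside cs = - pts (cycle_edges cs)"
  by (simp add: cycle_inside_def cycle_outside_def)

lemma closed_cycle_pts: "is_cycle E cs \<Longrightarrow> closed (pts (cycle_edges cs))"
  by (rule closed_pts) (simp add: is_cycle_def)

lemma open_cycle_inside: "is_cycle E cs \<Longrightarrow> open (cycle_inside cs)"
  unfolding cycle_inside_def by (intro open_inside closed_cycle_pts)

end

locale plane_disc = plane_graph V E \<phi> \<gamma> for V :: "'a set" and E \<phi> \<gamma> +
  fixes cs :: "'a list"
  assumes cycle: "is_cycle E cs"
    and vertex_inside: "v \<in> V \<Longrightarrow> v \<notin> set cs \<Longrightarrow> \<phi> v \<in> cycle_inside cs"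
    and edge_inside: "e \<in> E \<Longrightarrow> e \<notin> cycle_edges cs \<Longrightarrow> interior_edge e \<subseteq> cycle_inside cs"

context plane_graph
begin

definition region_V :: "'a list \<Rightarrow> complex set \<Rightarrow> 'a set" where
  "region_V cs R = {v \<in> V. v \<in> set cs \<or> \<phi> v \<in> R}"

definition region_E :: "'a list \<Rightarrow> complex set \<Rightarrow> 'a set set" where
  "region_E cs R = {e \<in> E. e \<in> cycle_edges cs \<or> interior_edge e \<subseteq> R}"

abbreviation inner_V :: "'a list \<Rightarrow> 'a set" where
  "inner_V cs \<equiv> region_V cs (cycle_inside cs)"

abbreviation inner_E :: "'a list \<Rightarrow> 'a set set" where
  "inner_E cs \<equiv> region_E cs (cycle_inside cs)"

abbreviation outer_V :: "'a list \<Rightarrow> 'a set" where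
  "outer_V cs \<equiv> region_V cs (cycle_outside cs)"

abbreviation outer_E :: "'a list \<Rightarrow> 'a set set" where
  "outer_E cs \<equiv> region_E cs (cycle_outside cs)"

lemma region_V_subset: "region_V cs R \<subseteq> V"
  by (auto simp: region_V_def)

lemma region_E_subset: "region_E cs R \<subseteq> E"
  by (auto simp: region_E_def)

lemma is_cycle_region_E: "is_cycle E cs \<Longrightarrow> is_cycle (region_E cs R) cs"
  by (auto simp: is_cycle_def region_E_def)

lemma plane_graph_region:
  assumes cycle: "is_cycle E cs" and R_closure: "closure R \<subseteq> pts (cycle_edges cs) \<union> R"
  shows "plane_graph (region_V cs R) (region_E cs R) \<phi> \<gamma>"
proof (rule plane_subgraph[OF region_V_subset region_E_subset], rule Union_least)
  fix e assume e_in_region: "e \<in> region_E cs R"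
  then have e_in_E: "e \<in> E" using region_E_subset by blast
  show "e \<subseteq> region_V cs R"
  proof (cases "e \<in> cycle_edges cs")
    case True
    then show ?thesis
      using cycle_edges_subset[OF True] cycle_subset_V[OF cycle] by (auto simp: region_V_def)
  next
    case False
    then have "closure (interior_edge e) \<subseteq> closure R"
      using e_in_region by (intro closure_mono) (simp add: region_E_def)
    then have "im e \<subseteq> pts (cycle_edges cs) \<union> R"
      using edge_subset_closure_interior[OF e_in_E] R_closure by (meson order_trans)
    then have "\<phi> ` e \<subseteq> pts (cycle_edges cs) \<union> R" using ends_in_im[OF e_in_E] by blast
    then show ?thesis
      using edge[OF e_in_E] cycle_vertex_in_pts_iff[OF cycle] unfolding region_V_def by blast
  qed
qed

lemma plane_disc_inner:
  assumes cycle: "is_cycle E cs"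
  shows "plane_disc (inner_V cs) (inner_E cs) \<phi> \<gamma> cs"
proof -
  interpret inner: plane_graph "inner_V cs" "inner_E cs" \<phi> \<gamma>
    using plane_graph_region[OF cycle] closure_inside_subset[OF closed_cycle_pts[OF cycle]]
    by (simp add: cycle_inside_def)
  show ?thesis
    using is_cycle_region_E[OF cycle]
    by unfold_locales (auto simp: region_V_def region_E_def cycle_inside_def inner.cycle_inside_def)
qed

lemma outer_disjoint_inside:
  assumes cycle: "is_cycle E cs"
  shows "\<phi> ` outer_V cs \<inter> cycle_inside cs = {}" "pts (outer_E cs) \<inter> cycle_inside cs = {}"
proof -
  interpret outer: plane_graph "outer_V cs" "outer_E cs" \<phi> \<gamma>
    using plane_graph_region[OF cycle] closure_outside_subset[OF closed_cycle_pts[OF cycle]]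
    by (simp add: cycle_outside_def)
  note disjoint = cycle_inside_disjoint[of cs] cycle_inside_Int_outside[of cs]
  have "\<phi> v \<in> pts (cycle_edges cs) \<union> cycle_outside cs" if "v \<in> outer_V cs" for v
    using that cycle_vertex_in_pts_iff[OF cycle, of v] by (auto simp: region_V_def)
  then show vertices: "\<phi> ` outer_V cs \<inter> cycle_inside cs = {}" using disjoint by blast
  have "im e \<subseteq> pts (cycle_edges cs) \<union> cycle_outside cs \<union> \<phi> ` outer_V cs" if "e \<in> outer_E cs" for e
    using that outer.edge[OF that] unfolding region_E_def by blast
  then show "pts (outer_E cs) \<inter> cycle_inside cs = {}" using disjoint vertices by blast
qed

text \<open>Inversion at a point inside the cycle turns the outer part into a disc.\<close>

lemma plane_disc_outer:
  assumes cycle: "is_cycle E cs"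
  obtains \<phi>' \<gamma>' where "plane_disc (outer_V cs) (outer_E cs) \<phi>' \<gamma>' cs"
proof -
  interpret outer: plane_graph "outer_V cs" "outer_E cs" \<phi> \<gamma>
    using plane_graph_region[OF cycle] closure_outside_subset[OF closed_cycle_pts[OF cycle]]
    by (simp add: cycle_outside_def)
  obtain g where g_loop: "simple_path g" "pathfinish g = pathstart g"
    and image: "path_image g = pts (cycle_edges cs)"
    by (rule cycle_curve[OF cycle])
  obtain p where "p \<in> inside (path_image g)" using Jordan_inside_outside[OF g_loop] by auto
  with g_loop interpret curve_inversion g p by unfold_locales
  have "p \<in> cycle_inside cs" using p_inside by (simp add: image cycle_inside_def)
  then have avoid: "\<phi> ` outer_V cs \<subseteq> - {p}" "outer.pts (outer_E cs) \<subseteq> - {p}"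
    using outer_disjoint_inside[OF cycle] by blast+
  interpret inverted: plane_graph "outer_V cs" "outer_E cs" "invert \<circ> \<phi>" "\<lambda>e. invert \<circ> \<gamma> e"
    by (rule outer.plane_graph_image[OF continuous_on_invert inj_invert avoid]) simp
  have inside: "inverted.cycle_inside cs = inside inverted_curve"
    unfolding inverted.cycle_inside_def by (simp add: path_image_compose image_UN image)
  have invert_outside: "invert ` cycle_outside cs \<subseteq> inside inverted_curve"
    using invert_outside_subset_inside by (simp add: image cycle_outside_def)
  have "plane_disc (outer_V cs) (outer_E cs) (invert \<circ> \<phi>) (\<lambda>e. invert \<circ> \<gamma> e) cs"
  proof (unfold_locales, unfold inside)
    show "is_cycle (outer_E cs) cs" by (rule is_cycle_region_E[OF cycle])
  next
    fix v assume "v \<in> outer_V cs" "v \<notin> set cs"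
    then have "\<phi> v \<in> cycle_outside cs" by (simp add: region_V_def)
    then show "(invert \<circ> \<phi>) v \<in> inside inverted_curve" using invert_outside by auto
  next
    fix e assume "e \<in> outer_E cs" "e \<notin> cycle_edges cs"
    then have "interior_edge e \<subseteq> cycle_outside cs" by (simp add: region_E_def)
    moreover have "path_image (invert \<circ> \<gamma> e) - (invert \<circ> \<phi>) ` e \<subseteq> invert ` interior_edge e"
      by (auto simp: path_image_compose)
    ultimately show "path_image (invert \<circ> \<gamma> e) - (invert \<circ> \<phi>) ` e \<subseteq> inside inverted_curve"
      using invert_outside by blast
  qed
  then show ?thesis by (rule that)
qed

lemma interior_edge_inside_or_outside:
  assumes "is_cycle E cs" "e \<in> E" "e \<notin> cycle_edges cs"
  shows "interior_edge e \<subseteq> cycle_inside cs \<or> interior_edge e \<subseteq> cycle_outside cs"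
  unfolding cycle_inside_def cycle_outside_def
proof (rule connected_subset_inside_or_outside)
  show "interior_edge e \<inter> pts (cycle_edges cs) = {}"
    using assms by (intro interior_edge_disjoint_pts) (auto simp: is_cycle_def)
qed (use assms connected_interior_edge closed_cycle_pts in auto)

lemma
  assumes cycle: "is_cycle E cs"
  shows inner_Un_outer_V: "inner_V cs \<union> outer_V cs = V"
    and inner_Int_outer_V: "inner_V cs \<inter> outer_V cs = set cs"
    and inner_Un_outer_E: "inner_E cs \<union> outer_E cs = E"
    and inner_Int_outer_E: "inner_E cs \<inter> outer_E cs = cycle_edges cs"
proof -
  note disj = cycle_inside_Int_outside[of cs]
  have "\<phi> v \<in> cycle_inside cs \<union> cycle_outside cs" if "v \<in> V" "v \<notin> set cs" for v
    using cycle_vertex_in_pts_iff[OF cycle that(1)] that(2) by (simp add: cycle_inside_Un_outside)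
  then show "inner_V cs \<union> outer_V cs = V" unfolding region_V_def by blast
  show "inner_V cs \<inter> outer_V cs = set cs"
    using disj cycle_subset_V[OF cycle] unfolding region_V_def by blast
  show "inner_E cs \<union> outer_E cs = E"
    using interior_edge_inside_or_outside[OF cycle] unfolding region_E_def by blast
  have "\<not> (interior_edge e \<subseteq> cycle_inside cs \<and> interior_edge e \<subseteq> cycle_outside cs)"
    if "e \<in> E" for e
    using interior_edge_nonempty[OF that] disj by blast
  moreover have "cycle_edges cs \<subseteq> E" using cycle by (simp add: is_cycle_def)
  ultimately show "inner_E cs \<inter> outer_E cs = cycle_edges cs" unfolding region_E_def by blast
qed

end

locale plane_disc_chord = plane_disc V E \<phi> \<gamma> "a # l @ b # r" for V :: "'a set" and E \<phi> \<gamma> a l b r +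
  fixes m :: "'a list"
  assumes distinct_chord: "distinct (a # m @ [b])"
    and chord_edges: "walk_edges (a # m @ [b]) \<subseteq> E - cycle_edges (a # l @ b # r)"
    and chord_inner: "set m \<inter> set (a # l @ b # r) = {}"
begin

abbreviation boundary :: "'a list" where
  "boundary \<equiv> a # l @ b # r"

abbreviation left_cycle :: "'a list" where
  "left_cycle \<equiv> a # l @ b # rev m"

abbreviation right_cycle :: "'a list" where
  "right_cycle \<equiv> b # r @ a # m"

definition left :: "'a set set" where "left = walk_edges (a # l @ [b])"
definition right :: "'a set set" where "right = walk_edges (b # r @ [a])"
definition chord :: "'a set set" where "chord = walk_edges (a # m @ [b])"

lemma boundary_edges: "cycle_edges boundary = left \<union> right"
  by (simp add: cycle_edges_split left_def right_def)

lemma chord_rev: "walk_edges (b # rev m @ [a]) = chord"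
  using walk_edges_rev[of "a # m @ [b]"] by (simp add: chord_def)

lemma left_edges: "cycle_edges left_cycle = left \<union> chord"
  by (simp add: cycle_edges_split left_def chord_rev)

lemma right_edges: "cycle_edges right_cycle = right \<union> chord"
  by (simp add: cycle_edges_split right_def chord_def)

lemma sides_subset_E: "left \<subseteq> E" "right \<subseteq> E" "chord \<subseteq> E"
  using cycle chord_edges by (auto simp: is_cycle_def boundary_edges chord_def)

lemma chord_disjoint: "chord \<inter> (left \<union> right) = {}"
  using chord_edges by (auto simp: boundary_edges chord_def)

lemma left_Int_right: "left \<inter> right = {}"
  unfolding left_def right_def
  using cycle by (intro cycle_edges_split_disjoint) (simp_all add: is_cycle_def)

lemma Union_chord: "\<Union> chord = set (a # m @ [b])"
  unfolding chord_def by (rule Union_walk_edges) simp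

lemma is_cycle_left: "is_cycle E left_cycle" and is_cycle_right: "is_cycle E right_cycle"
proof -
  have "l \<noteq> [] \<or> m \<noteq> []" "r \<noteq> [] \<or> m \<noteq> []"
    using chord_disjoint by (auto simp: chord_def left_def right_def insert_commute)
  then have "3 \<le> length left_cycle" "3 \<le> length right_cycle"
    by (auto simp: Suc_le_eq numeral_3_eq_3)
  moreover have "distinct left_cycle" "distinct right_cycle"
    using cycle distinct_chord chord_inner by (auto simp: is_cycle_def)
  ultimately show "is_cycle E left_cycle" "is_cycle E right_cycle"
    using sides_subset_E by (auto simp: is_cycle_def left_edges right_edges)
qed

lemma chord_meets_inside: "pts chord \<inter> cycle_inside boundary \<noteq> {}"
proof -
  have "a \<in> \<Union> chord" unfolding Union_chord by simp
  then obtain e where e_chord: "e \<in> chord" by blast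
  then have "e \<in> E" "e \<notin> cycle_edges boundary"
    using sides_subset_E chord_disjoint by (auto simp: boundary_edges)
  then show ?thesis
    using edge_inside[of e] interior_edge_nonempty[of e] e_chord by blast
qed

lemma
  shows insides_disjoint: "cycle_inside left_cycle \<inter> cycle_inside right_cycle = {}"
    and insides_Un: "cycle_inside left_cycle \<union> cycle_inside right_cycle
      \<union> (pts chord - {\<phi> a, \<phi> b}) = cycle_inside boundary"
proof -
  have "\<exists>g. arc g \<and> pathstart g = \<phi> (hd xs) \<and> pathfinish g = \<phi> (last xs) \<and>
      path_image g = pts (walk_edges xs)"
    if "xs \<in> {a # l @ [b], rev (b # r @ [a]), a # m @ [b]}" for xs
    using that cycle distinct_chord sides_subset_E unfolding left_def right_def chord_def
    by (intro path_arc) (auto simp: is_cycle_def walk_edges_rev simp del: rev.simps)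
  from this[of "a # l @ [b]"] this[of "rev (b # r @ [a])"] this[of "a # m @ [b]"]
  obtain g1 g2 h
    where left_arc: "arc g1" "pathstart g1 = \<phi> a" "pathfinish g1 = \<phi> b" "path_image g1 = pts left"
    and right_arc: "arc g2" "pathstart g2 = \<phi> a" "pathfinish g2 = \<phi> b" "path_image g2 = pts right"
    and chord_arc: "arc h" "pathstart h = \<phi> a" "pathfinish h = \<phi> b" "path_image h = pts chord"
    unfolding left_def right_def chord_def walk_edges_rev by auto
  have arcs_Int: "pts left \<inter> pts right = {\<phi> a, \<phi> b}" "pts left \<inter> pts chord = {\<phi> a, \<phi> b}"
    "pts right \<inter> pts chord = {\<phi> a, \<phi> b}"
    using cycle_halves_Int[OF cycle] cycle_halves_Int[OF is_cycle_left]
      cycle_halves_Int[OF is_cycle_right]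
    unfolding chord_rev by (auto simp: left_def right_def chord_def)
  have "\<phi> a \<noteq> \<phi> b"
    using cycle_subset_V[OF cycle] cycle inj by (auto simp: is_cycle_def inj_on_def)
  note theta = split_inside_simple_closed_curve[OF arc_imp_simple_path[OF left_arc(1)] left_arc(2,3)
      arc_imp_simple_path[OF right_arc(1)] right_arc(2,3) arc_imp_simple_path[OF chord_arc(1)]
        chord_arc(2,3) this,
      unfolded left_arc(4) right_arc(4) chord_arc(4), OF arcs_Int]
  show "cycle_inside left_cycle \<inter> cycle_inside right_cycle = {}"
    "cycle_inside left_cycle \<union> cycle_inside right_cycle
     \<union> (pts chord - {\<phi> a, \<phi> b}) = cycle_inside boundary"
    using chord_meets_inside theta
    unfolding cycle_inside_def boundary_edges left_edges right_edges image_Un Union_Un_distrib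
    by blast+
qed

abbreviation left_V :: "'a set" where
  "left_V \<equiv> inner_V left_cycle"

abbreviation left_E :: "'a set set" where
  "left_E \<equiv> inner_E left_cycle"

abbreviation right_V :: "'a set" where
  "right_V \<equiv> inner_V right_cycle"

abbreviation right_E :: "'a set set" where
  "right_E \<equiv> inner_E right_cycle"

lemma left_E_Un_right_E: "left_E \<union> right_E = E"
proof (intro equalityI subsetI)
  fix e assume e_in_E: "e \<in> E"
  show "e \<in> left_E \<union> right_E"
  proof (cases "e \<in> left \<union> right \<union> chord")
    case True
    then show ?thesis using e_in_E by (auto simp: region_E_def left_edges right_edges)
  next
    case False
    have "interior_edge e \<subseteq> cycle_inside boundary"
      using edge_inside[OF e_in_E] False by (simp add: boundary_edges)
    also have "\<dots> \<subseteq> pts chord \<union> (cycle_inside left_cycle \<union> cycle_inside right_cycle)"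
      unfolding insides_Un[symmetric] by (intro Un_mono Un_least) auto
    finally have "interior_edge e \<subseteq> cycle_inside left_cycle \<union> cycle_inside right_cycle"
      using interior_edge_disjoint_pts[OF e_in_E sides_subset_E(3)] False
      by (metis Diff_subset_conv Diff_triv UnI2)
    then have "interior_edge e \<subseteq> cycle_inside left_cycle
        \<or> interior_edge e \<subseteq> cycle_inside right_cycle"
      using Topological_Spaces.connectedD[OF connected_interior_edge[OF e_in_E]
          open_cycle_inside[OF is_cycle_left] open_cycle_inside[OF is_cycle_right]]
        insides_disjoint by blast
    then show ?thesis using e_in_E unfolding region_E_def by blast
  qed
qed (auto simp: region_E_def)

lemma left_E_Int_right_E: "left_E \<inter> right_E = chord"
proof (intro equalityI subsetI)
  fix e assume e_both: "e \<in> left_E \<inter> right_E"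
  then have e_in_E: "e \<in> E" using region_E_subset by blast
  have not_both: "\<not> (interior_edge e \<subseteq> cycle_inside left_cycle
      \<and> interior_edge e \<subseteq> cycle_inside right_cycle)"
    using interior_edge_nonempty[OF e_in_E] insides_disjoint by blast
  have not_inside: "\<not> interior_edge e \<subseteq> cycle_inside left_cycle"
    "\<not> interior_edge e \<subseteq> cycle_inside right_cycle" if "e \<in> left \<union> right"
    using cycle_edge_not_inside[OF e_in_E, of boundary] that insides_Un
    unfolding boundary_edges by blast+
  show "e \<in> chord"
    using e_both not_both not_inside left_Int_right
    unfolding region_E_def left_edges right_edges by blast
qed (use sides_subset_E in \<open>auto simp: region_E_def left_edges right_edges\<close>)

lemma left_V_Un_right_V: "left_V \<union> right_V = V"
proof (intro equalityI subsetI)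
  fix v assume v_in_V: "v \<in> V"
  show "v \<in> left_V \<union> right_V"
  proof (cases "v \<in> set boundary \<union> set m")
    case True
    then show ?thesis using v_in_V by (auto simp: region_V_def)
  next
    case False
    have "\<phi> v \<notin> pts chord"
      using vertex_in_pts[OF sides_subset_E(3) v_in_V] False unfolding Union_chord by auto
    moreover have "\<phi> v \<in> cycle_inside boundary" using vertex_inside[OF v_in_V] False by blast
    ultimately show ?thesis using v_in_V insides_Un unfolding region_V_def by blast
  qed
qed (auto simp: region_V_def)

lemma left_V_Int_right_V: "left_V \<inter> right_V = set (a # m @ [b])"
proof (intro equalityI subsetI)
  fix v assume v_both: "v \<in> left_V \<inter> right_V"
  then have v_in_V: "v \<in> V" using region_V_subset by blast
  have "\<phi> v \<notin> cycle_inside boundary" if "v \<in> set boundary"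
    using cycle_vertex_in_pts_iff[OF cycle v_in_V] that cycle_inside_disjoint by blast
  then have not_inside: "\<phi> v \<notin> cycle_inside left_cycle"
    "\<phi> v \<notin> cycle_inside right_cycle" if "v \<in> set boundary"
    using insides_Un that by blast+
  have not_both: "\<not> (\<phi> v \<in> cycle_inside left_cycle \<and> \<phi> v \<in> cycle_inside right_cycle)"
    using insides_disjoint by blast
  have "v \<in> set left_cycle \<and> v \<in> set right_cycle \<or> v \<in> set m"
    using v_both not_inside not_both by (auto simp: region_V_def)
  then show "v \<in> set (a # m @ [b])" using cycle by (auto simp: is_cycle_def)
next
  fix v assume "v \<in> set (a # m @ [b])"
  then show "v \<in> left_V \<inter> right_V"
    using cycle_subset_V[OF is_cycle_left] by (auto simp: region_V_def)
qed

end

section \<open>Counting triangles of a plane graph\<close>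

definition triangle_packing :: "'a set set \<Rightarrow> 'a set set \<Rightarrow> 'a set set \<Rightarrow> bool" where
  "triangle_packing E C T \<longleftrightarrow> T \<subseteq> triangles E \<and>
     (\<forall>e\<in>E. card {t \<in> T. e \<subseteq> t} \<le> (if e \<in> C then 1 else 2))"

definition triangle_bound :: "'a set \<Rightarrow> 'a set set \<Rightarrow> 'a set set \<Rightarrow> nat \<Rightarrow> bool" where
  "triangle_bound V E C s \<longleftrightarrow>
     (\<exists>T. triangle_packing E C T \<and> 2 * card E + s \<le> card T + 4 * card V)"

text \<open>
  With \<open>f\<close> faces, \<open>|V| - |E| + f \<ge> 2\<close> and \<open>2|E| \<ge> 4f - |T|\<close> suggest 8 instead of 6 in
  \<open>plane_bound\<close>. This fails for a single edge and for a lone triangle, which is two faces but one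
  element of \<open>T\<close>. In \<open>disc_bound\<close> the outer face enters with its exact length.
\<close>

abbreviation plane_bound :: "'a set \<Rightarrow> 'a set set \<Rightarrow> bool" where
  "plane_bound V E \<equiv> triangle_bound V E {} 6"

abbreviation disc_bound :: "'a set \<Rightarrow> 'a set set \<Rightarrow> 'a list \<Rightarrow> bool" where
  "disc_bound V E cs \<equiv> triangle_bound V E (cycle_edges cs) (length cs + 4)"

lemma triangle_packing_subset_triangles: "triangle_packing E C T \<Longrightarrow> T \<subseteq> triangles E"
  by (simp add: triangle_packing_def)

lemma card_packed_triangles_at_edge:
  "triangle_packing E C T \<Longrightarrow> e \<in> E \<Longrightarrow> card {t \<in> T. e \<subseteq> t} \<le> (if e \<in> C then 1 else 2)"
  by (simp add: triangle_packing_def)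

lemma no_packed_triangle_over_nonedge:
  assumes "triangle_packing E C T" "card e = 2" "e \<notin> E"
  shows "card {t \<in> T. e \<subseteq> t} = 0"
proof -
  have "{t \<in> T. e \<subseteq> t} = {}"
    using assms in_edges_if_subset_triangle unfolding triangle_packing_def by blast
  then show ?thesis by (simp only: card.empty)
qed

lemma (in simple_graph) triangle_packing_subset:
  assumes packing: "triangle_packing F C T" and "F \<subseteq> E" and capacity: "F \<inter> D \<subseteq> C"
  shows "triangle_packing E D T"
proof -
  have "card {t \<in> T. e \<subseteq> t} \<le> (if e \<in> D then 1 else 2)" if "e \<in> E" for e
  proof (cases "e \<in> F")
    case True
    then show ?thesis
      using card_packed_triangles_at_edge[OF packing, of e] capacity by (auto split: if_splits)
  next
    case False
    then show ?thesis using no_packed_triangle_over_nonedge[OF packing] edge[OF that] by simp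
  qed
  moreover have "T \<subseteq> triangles E"
    using triangle_packing_subset_triangles[OF packing] triangles_mono[OF \<open>F \<subseteq> E\<close>] by blast
  ultimately show ?thesis by (simp add: triangle_packing_def)
qed

lemma (in simple_graph) triangle_packing_finite: "triangle_packing E C T \<Longrightarrow> finite T"
  using finite_triangles finite_subset[OF Union_E_subset finite_V]
  by (auto simp: triangle_packing_def intro: finite_subset)

lemma (in simple_graph) triangle_packing_Un:
  assumes packing1: "triangle_packing E1 C1 T1" and packing2: "triangle_packing E2 C2 T2"
    and edges_Un: "E1 \<union> E2 = E" and shared: "E1 \<inter> E2 \<subseteq> C1 \<inter> C2 - C"
    and capacity: "E1 \<inter> C \<subseteq> C1" "E2 \<inter> C \<subseteq> C2"
  shows "triangle_packing E C (T1 \<union> T2)"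
proof -
  have in_E: "triangle_packing E C T1" "triangle_packing E C T2"
    using triangle_packing_subset[OF packing1] triangle_packing_subset[OF packing2]
      edges_Un capacity by auto
  have "card {t \<in> T1 \<union> T2. e \<subseteq> t} \<le> (if e \<in> C then 1 else 2)" if e_in_E: "e \<in> E" for e
  proof -
    have "{t \<in> T1 \<union> T2. e \<subseteq> t} = {t \<in> T1. e \<subseteq> t} \<union> {t \<in> T2. e \<subseteq> t}" by auto
    then have card_le: "card {t \<in> T1 \<union> T2. e \<subseteq> t} \<le> card {t \<in> T1. e \<subseteq> t} + card {t \<in> T2. e \<subseteq> t}"
      by (simp only: card_Un_le)
    have card_e: "card e = 2" using edge[OF e_in_E] by simp
    consider "e \<in> E1" "e \<in> E2" | "e \<notin> E1" | "e \<notin> E2" by blast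
    then show ?thesis
    proof cases
      case 1
      then have "e \<in> C1" "e \<in> C2" "e \<notin> C" using shared by auto
      with 1 show ?thesis
        using card_packed_triangles_at_edge[OF packing1, of e]
          card_packed_triangles_at_edge[OF packing2, of e] card_le by simp
    next
      case 2
      then show ?thesis
        using card_le no_packed_triangle_over_nonedge[OF packing1 card_e]
          card_packed_triangles_at_edge[OF in_E(2) e_in_E] by linarith
    next
      case 3
      then show ?thesis
        using card_le no_packed_triangle_over_nonedge[OF packing2 card_e]
          card_packed_triangles_at_edge[OF in_E(1) e_in_E] by linarith
    qed
  qed
  then show ?thesis using in_E by (simp add: triangle_packing_def)
qed

lemma (in simple_graph) triangle_bound_Un:
  assumes bound1: "triangle_bound V1 E1 C1 s1" and bound2: "triangle_bound V2 E2 C2 s2"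
    and vertices_Un: "V1 \<union> V2 = V" and edges_Un: "E1 \<union> E2 = E"
    and shared: "E1 \<inter> E2 \<subseteq> C1 \<inter> C2 - C" and capacity: "E1 \<inter> C \<subseteq> C1" "E2 \<inter> C \<subseteq> C2"
    and slack: "s + 4 * card (V1 \<inter> V2) + card (triangles (E1 \<inter> E2)) \<le> s1 + s2 + 2 * card (E1 \<inter> E2)"
  shows "triangle_bound V E C s"
proof -
  obtain T1 where T1_packing: "triangle_packing E1 C1 T1" "2 * card E1 + s1 \<le> card T1 + 4 * card V1"
    using bound1 by (auto simp: triangle_bound_def)
  obtain T2 where T2_packing: "triangle_packing E2 C2 T2" "2 * card E2 + s2 \<le> card T2 + 4 * card V2"
    using bound2 by (auto simp: triangle_bound_def)
  have packing: "triangle_packing E C (T1 \<union> T2)"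
    by (rule triangle_packing_Un[OF T1_packing(1) T2_packing(1) edges_Un shared capacity])
  have "T1 \<inter> T2 \<subseteq> triangles (E1 \<inter> E2)"
    using T1_packing(1) T2_packing(1) by (auto simp: triangle_packing_def triangles_Int)
  moreover have "finite (triangles (E1 \<inter> E2))"
    using finite_subset[OF _ finite_V, of "\<Union> (E1 \<inter> E2)"] Union_E_subset edges_Un
    by (intro finite_triangles) blast
  ultimately have "card (T1 \<inter> T2) \<le> card (triangles (E1 \<inter> E2))" by (intro card_mono)
  moreover have "card T1 + card T2 = card (T1 \<union> T2) + card (T1 \<inter> T2)"
    using triangle_packing_finite[OF packing] by (intro card_Un_Int) auto
  moreover have "card V1 + card V2 = card V + card (V1 \<inter> V2)"
    unfolding vertices_Un[symmetric] using vertices_Un finite_V by (intro card_Un_Int) auto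
  moreover have "card E1 + card E2 = card E + card (E1 \<inter> E2)"
    unfolding edges_Un[symmetric] using edges_Un finite_E by (intro card_Un_Int) auto
  ultimately have "2 * card E + s \<le> card (T1 \<union> T2) + 4 * card V"
    using T1_packing(2) T2_packing(2) slack by linarith
  then show ?thesis using packing by (auto simp: triangle_bound_def)
qed

lemma (in simple_graph) disc_bound_cycle:
  assumes cycle: "is_cycle E cs" and edges_eq: "E = cycle_edges cs"
  shows "disc_bound V E cs"
proof -
  have "card (set cs) \<le> card V"
    using cycle_subset_V[OF cycle] finite_V by (rule card_mono[rotated])
  then have length_le: "length cs \<le> card V" using cycle by (simp add: is_cycle_def distinct_card)
  have card_E: "card E = length cs"
    using card_cycle_edges cycle edges_eq by (auto simp: is_cycle_def)
  show ?thesis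
  proof (cases "length cs = 3")
    case True
    then obtain x y z where cs: "cs = [x, y, z]" by (auto simp: length_Suc_conv numeral_3_eq_3)
    then have "{x, y, z} \<in> triangles E"
      using cycle by
        (auto simp: insert_in_triangles_iff is_cycle_def cycle_edges_def insert_commute)
    moreover have "card {t \<in> {set cs}. e \<subseteq> t} \<le> 1" for e
      using card_mono[of "{set cs}" "{t \<in> {set cs}. e \<subseteq> t}"] by auto
    ultimately have "triangle_packing E (cycle_edges cs) {set cs}"
      using edges_eq cs by (auto simp: triangle_packing_def)
    then show ?thesis unfolding triangle_bound_def
      using True length_le card_E by (intro exI[of _ "{set cs}"]) simp
  next
    case False
    have "triangle_packing E (cycle_edges cs) {}" by (simp add: triangle_packing_def)
    then show ?thesis
      unfolding triangle_bound_def using False length_le card_E cycle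
      by (intro exI[of _ "{}"]) (simp add: is_cycle_def)
  qed
qed

lemma (in simple_graph) plane_bound_remove_vertex:
  assumes deg_v: "v \<in> V" "deg v \<le> 2" and bound: "plane_bound (V - {v}) {e \<in> E. v \<notin> e}"
  shows "plane_bound V E"
proof -
  obtain T where T_packing: "triangle_packing {e \<in> E. v \<notin> e} {} T"
    "2 * card {e \<in> E. v \<notin> e} + 6 \<le> card T + 4 * card (V - {v})"
    using bound by (auto simp: triangle_bound_def)
  have "E = {e \<in> E. v \<notin> e} \<union> {e \<in> E. v \<in> e}" by auto
  also have "card \<dots> = card {e \<in> E. v \<notin> e} + deg v"
    unfolding deg_eq_card_incident_edges using finite_E by (intro card_Un_disjoint) auto
  finally have "card E \<le> card {e \<in> E. v \<notin> e} + 2" using deg_v by simp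
  moreover have "card V = card (V - {v}) + 1"
    using deg_v finite_V by (metis Suc_eq_plus1 card_Suc_Diff1)
  ultimately have "2 * card E + 6 \<le> card T + 4 * card V" using T_packing(2) by linarith
  moreover have "triangle_packing E {} T" by (rule triangle_packing_subset[OF T_packing(1)]) auto
  ultimately show ?thesis unfolding triangle_bound_def by blast
qed

lemma (in simple_graph) plane_bound_two_vertices:
  assumes "card V = 2"
  shows "plane_bound V E"
proof -
  have "E \<subseteq> {V}" using edge assms card_subset_eq[OF finite_V] by (metis insertI1 subsetI)
  then have "card E \<le> 1" using card_mono[of "{V}" E] by auto
  moreover have "triangle_packing E {} {}" by (simp add: triangle_packing_def)
  ultimately show ?thesis
    unfolding triangle_bound_def using assms by (intro exI[of _ "{}"]) simp
qed

lemma (in plane_disc_chord) disc_bound_chord: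
  assumes left: "disc_bound left_V left_E left_cycle"
    and right: "disc_bound right_V right_E right_cycle"
  shows "disc_bound V E boundary"
proof (rule triangle_bound_Un[OF left right left_V_Un_right_V left_E_Un_right_E])
  have no_triangles: "triangles (left_E \<inter> right_E) = {}"
    unfolding left_E_Int_right_E chord_def by (rule triangles_walk_edges[OF distinct_chord])
  have "card (left_E \<inter> right_E) = length m + 1" "card (left_V \<inter> right_V) = length m + 2"
    unfolding left_E_Int_right_E left_V_Int_right_V chord_def
    using distinct_chord card_walk_edges[OF distinct_chord] distinct_card[OF distinct_chord]
    by simp_all
  then show "length boundary + 4 + 4 * card (left_V \<inter> right_V) + card (triangles (left_E \<inter> right_E))
      \<le> length left_cycle + 4 + (length right_cycle + 4) + 2 * card (left_E \<inter> right_E)"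
    using no_triangles by simp
next
  show "left_E \<inter> right_E \<subseteq> cycle_edges left_cycle \<inter> cycle_edges right_cycle - cycle_edges boundary"
    using chord_disjoint
    unfolding left_E_Int_right_E left_edges right_edges boundary_edges by blast
  have "left \<subseteq> left_E" "right \<subseteq> right_E"
    using is_cycle_region_E[OF is_cycle_left] is_cycle_region_E[OF is_cycle_right]
    by (simp_all add: is_cycle_def left_edges right_edges)
  then show "left_E \<inter> cycle_edges boundary \<subseteq> cycle_edges left_cycle"
    "right_E \<inter> cycle_edges boundary \<subseteq> cycle_edges right_cycle"
    using left_E_Int_right_E unfolding boundary_edges left_edges right_edges by blast+
qed

lemma (in plane_disc) disc_bound_if_chord:
  assumes chord: "a \<in> set cs" "b \<in> set cs" "distinct (a # m @ [b])"
      "walk_edges (a # m @ [b]) \<subseteq> E - cycle_edges cs" "set m \<inter> set cs = {}"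
    and IH: "\<And>V' E' cs'. plane_disc V' E' \<phi> \<gamma> cs' \<Longrightarrow>
      card (E' - cycle_edges cs') < card (E - cycle_edges cs) \<Longrightarrow> disc_bound V' E' cs'"
  shows "disc_bound V E cs"
proof -
  obtain xs ys where "cs = xs @ a # ys" using chord(1) by (meson split_list)
  define cs0 where "cs0 = ys @ xs"
  have rotated: "cycle_edges (a # cs0) = cycle_edges cs" "set (a # cs0) = set cs"
    "length (a # cs0) = length cs" "distinct (a # cs0) = distinct cs"
    using cycle_edges_append_commute[of xs "a # ys"] \<open>cs = xs @ a # ys\<close> by (auto simp: cs0_def)
  have "b \<in> set cs0" using rotated(2) chord by auto
  then obtain l r where "cs0 = l @ b # r" by (meson split_list)
  note rotated = rotated[unfolded this]
  interpret plane_disc_chord V E \<phi> \<gamma> a l b r m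
    using cycle vertex_inside edge_inside chord
    by unfold_locales (simp_all only: rotated is_cycle_def cycle_inside_def)
  have "chord \<noteq> {}" using Union_chord by auto
  moreover have "left_E - cycle_edges left_cycle \<subseteq> E - cycle_edges boundary - chord"
    "right_E - cycle_edges right_cycle \<subseteq> E - cycle_edges boundary - chord"
    using left_E_Int_right_E region_E_subset is_cycle_region_E[OF is_cycle_left]
      is_cycle_region_E[OF is_cycle_right]
    unfolding is_cycle_def boundary_edges left_edges right_edges by blast+
  moreover have "chord \<subseteq> E - cycle_edges boundary"
    using sides_subset_E chord_disjoint unfolding boundary_edges by blast
  ultimately have "left_E - cycle_edges left_cycle \<subset> E - cycle_edges boundary"
    "right_E - cycle_edges right_cycle \<subset> E - cycle_edges boundary" by blast+
  then have "card (left_E - cycle_edges left_cycle) < card (E - cycle_edges cs)"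
    "card (right_E - cycle_edges right_cycle) < card (E - cycle_edges cs)"
    unfolding rotated(1) using finite_E by (auto intro: psubset_card_mono)
  then have "disc_bound left_V left_E left_cycle" "disc_bound right_V right_E right_cycle"
    using IH plane_disc_inner[OF is_cycle_left] plane_disc_inner[OF is_cycle_right] by blast+
  from disc_bound_chord[OF this] show ?thesis unfolding rotated(1,3) .
qed

text \<open>
  If a disc contains an edge but no chord path, some component of the inner vertices has at most
  one neighbour on the cycle; it is a plane graph of its own, and it can be cut off.
\<close>

lemma (in plane_disc) disc_bound_cut_component:
  assumes x_inner: "x \<in> V" "x \<notin> set cs"
  defines "K \<equiv> component_outside E (set cs) x"
  defines "A \<equiv> {a \<in> set cs. nbr a \<inter> K \<noteq> {}}" and "F \<equiv> {e \<in> E. e \<inter> K \<noteq> {}}"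
  assumes few_attachments: "card A \<le> 1"
    and component: "plane_graph (K \<union> A) F \<phi> \<gamma> \<Longrightarrow> plane_bound (K \<union> A) F"
    and rest: "plane_disc (V - K) (E - F) \<phi> \<gamma> cs \<Longrightarrow> disc_bound (V - K) (E - F) cs"
  shows "disc_bound V E cs"
proof -
  have K_inner: "K \<subseteq> V" "K \<inter> set cs = {}"
    using component_outside_subset_V[OF x_inner(1)] component_outside_disjoint[OF x_inner(2)]
    by (auto simp: K_def)
  have A_outer: "A \<subseteq> V" "A \<inter> K = {}" using cycle_subset_V[OF cycle] K_inner by (auto simp: A_def)
  have F_cycle: "F \<inter> cycle_edges cs = {}"
    using K_inner(2) cycle_edges_subset by (fastforce simp: F_def)
  have "e \<subseteq> K \<union> A" if e_in_F: "e \<in> F" for e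
  proof -
    obtain k where k_in_e: "k \<in> e" "k \<in> K" "e \<in> E" using e_in_F by (auto simp: F_def)
    then obtain y where e_eq: "e = {k, y}" by (metis edge_endpoints)
    then show ?thesis
      using k_in_e component_outside_closed[OF x_inner(2), of k E y]
      by (auto simp: A_def K_def neighbours_def insert_commute)
  qed
  then have "plane_graph (K \<union> A) F \<phi> \<gamma>"
    using K_inner A_outer by (intro plane_subgraph) (auto simp: F_def)
  then have bound_K: "plane_bound (K \<union> A) F" by (rule component)
  interpret rest: plane_graph "V - K" "E - F" \<phi> \<gamma>
    by (rule plane_subgraph) (use edge in \<open>auto simp: F_def\<close>)
  have "plane_disc (V - K) (E - F) \<phi> \<gamma> cs"
    using cycle F_cycle vertex_inside edge_inside by unfold_locales (auto simp: is_cycle_def)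
  then have bound_rest: "disc_bound (V - K) (E - F) cs" by (rule rest)
  show ?thesis
  proof (rule triangle_bound_Un[OF bound_K bound_rest])
    have "(K \<union> A) \<inter> (V - K) = A" using A_outer by auto
    then show "length cs + 4 + 4 * card ((K \<union> A) \<inter> (V - K)) + card (triangles (F \<inter> (E - F)))
        \<le> 6 + (length cs + 4) + 2 * card (F \<inter> (E - F))"
      using few_attachments by simp
  qed (use K_inner A_outer F_cycle in \<open>auto simp: F_def\<close>)
qed

lemma (in plane_disc) disc_bound_if_two_attachments:
  assumes x_inner: "x \<notin> set cs"
    and two: "\<not> card {a \<in> set cs. nbr a \<inter> component_outside E (set cs) x \<noteq> {}} \<le> 1"
    and IH: "\<And>V' E' cs'. plane_disc V' E' \<phi> \<gamma> cs' \<Longrightarrow>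
      card (E' - cycle_edges cs') < card (E - cycle_edges cs) \<Longrightarrow> disc_bound V' E' cs'"
  shows "disc_bound V E cs"
proof -
  let ?A = "{a \<in> set cs. nbr a \<inter> component_outside E (set cs) x \<noteq> {}}"
  obtain a b where ab_attached: "a \<in> ?A" "b \<in> ?A" "a \<noteq> b"
    using two card_le_Suc0_iff_eq[of ?A] by auto
  then obtain m where m_path: "m \<noteq> []" "distinct (a # m @ [b])" "set m \<inter> set cs = {}"
    "walk_edges (a # m @ [b]) \<subseteq> E"
    using path_through_component_outside[of x "set cs" a b E] x_inner by auto
  have "walk_edges (a # m @ [b]) \<inter> cycle_edges cs = {}"
    using walk_edges_meet_inner[OF m_path(1)] m_path(3) cycle_edges_subset by fastforce
  then show ?thesis
    using disc_bound_if_chord[of a b m, OF _ _ _ _ _ IH] ab_attached m_path by auto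
qed

lemma (in plane_disc) disc_bound_step:
  assumes IH: "\<And>V' E' cs'. plane_disc V' E' \<phi> \<gamma> cs' \<Longrightarrow>
      card (E' - cycle_edges cs') < card (E - cycle_edges cs) \<Longrightarrow> disc_bound V' E' cs'"
    and plane: "\<And>V' E'. plane_graph V' E' \<phi> \<gamma> \<Longrightarrow> 2 \<le> card V' \<Longrightarrow>
      card E' \<le> card (E - cycle_edges cs) \<Longrightarrow> plane_bound V' E'"
  shows "disc_bound V E cs"
proof (cases "E = cycle_edges cs")
  case True
  then show ?thesis using cycle by (rule disc_bound_cycle[rotated])
next
  case False
  then obtain e where e_inner: "e \<in> E" "e \<notin> cycle_edges cs"
    using cycle by (auto simp: is_cycle_def)
  obtain p q where e_eq: "e = {p, q}" "p \<noteq> q" using edge[OF e_inner(1)] by (auto simp: card_2_iff)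
  show ?thesis
  proof (cases "e \<subseteq> set cs")
    case True
    then show ?thesis using disc_bound_if_chord[of p q "[]", OF _ _ _ _ _ IH] e_eq e_inner by auto
  next
    case False
    then obtain x where x_inner: "x \<in> e" "x \<in> V" "x \<notin> set cs" using edge[OF e_inner(1)] by auto
    let ?K = "component_outside E (set cs) x"
    let ?A = "{a \<in> set cs. nbr a \<inter> ?K \<noteq> {}}" and ?F = "{e \<in> E. e \<inter> ?K \<noteq> {}}"
    have e_F: "e \<in> ?F" using e_inner x_inner in_component_outside_self[of x] by auto
    have F_cycle: "?F \<inter> cycle_edges cs = {}"
      using component_outside_disjoint[OF x_inner(3)] cycle_edges_subset by fastforce
    have component: "plane_bound (?K \<union> ?A) ?F" if "plane_graph (?K \<union> ?A) ?F \<phi> \<gamma>"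
    proof (rule plane[OF that])
      interpret K: plane_graph "?K \<union> ?A" ?F \<phi> \<gamma> by (rule that)
      show "2 \<le> card (?K \<union> ?A)"
        using K.edge[OF e_F] card_mono[OF K.finite_V, of e] by simp
      show "card ?F \<le> card (E - cycle_edges cs)"
        using F_cycle finite_E by (intro card_mono) auto
    qed
    have "disc_bound (V - ?K) (E - ?F) cs" if "plane_disc (V - ?K) (E - ?F) \<phi> \<gamma> cs"
      by (rule IH[OF that], rule psubset_card_mono) (use finite_E e_inner e_F in auto)
    then show ?thesis
      using disc_bound_cut_component[OF x_inner(2,3) _ component]
        disc_bound_if_two_attachments[OF x_inner(3) _ IH]
      by blast
  qed
qed

lemma (in plane_graph) plane_bound_cycle:
  assumes cycle: "is_cycle E cs"
    and disc: "\<And>V' E' \<phi>' \<gamma>'. plane_disc V' E' \<phi>' \<gamma>' cs \<Longrightarrow>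
      card (E' - cycle_edges cs) < card E \<Longrightarrow> disc_bound V' E' cs"
  shows "plane_bound V E"
proof (rule triangle_bound_Un[OF _ _ inner_Un_outer_V[OF cycle] inner_Un_outer_E[OF cycle]])
  have cs: "distinct cs" "3 \<le> length cs" "cycle_edges cs \<subseteq> E"
    using cycle by (auto simp: is_cycle_def)
  then have "cycle_edges cs \<noteq> {}" using card_cycle_edges[of cs] by auto
  have smaller: "card (region_E cs R - cycle_edges cs) < card E" for R
    by (rule psubset_card_mono[OF finite_E])
      (use \<open>cycle_edges cs \<noteq> {}\<close> cs(3) region_E_subset in blast)
  show "disc_bound (inner_V cs) (inner_E cs) cs"
    by (rule disc[OF plane_disc_inner[OF cycle] smaller])
  obtain \<phi>' \<gamma>' where "plane_disc (outer_V cs) (outer_E cs) \<phi>' \<gamma>' cs"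
    by (rule plane_disc_outer[OF cycle])
  then show "disc_bound (outer_V cs) (outer_E cs) cs" by (rule disc[OF _ smaller])
  have "card (triangles (cycle_edges cs)) \<le> 1"
    using card_mono[OF _ triangles_cycle_edges[OF cs(1,2)]] by simp
  then show "6 + 4 * card (inner_V cs \<inter> outer_V cs) + card (triangles (inner_E cs \<inter> outer_E cs))
      \<le> length cs + 4 + (length cs + 4) + 2 * card (inner_E cs \<inter> outer_E cs)"
    unfolding inner_Int_outer_V[OF cycle] inner_Int_outer_E[OF cycle]
    using cs by (simp add: distinct_card card_cycle_edges)
qed (use inner_Int_outer_E[OF cycle] in auto)

lemma plane_bound_step:
  fixes V :: "'a set"
  assumes disc: "\<And>(V :: 'a set) E \<phi> \<gamma> cs. plane_disc V E \<phi> \<gamma> cs \<Longrightarrow>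
      card (E - cycle_edges cs) < n \<Longrightarrow> disc_bound V E cs"
  shows "plane_graph V E \<phi> \<gamma> \<Longrightarrow> 2 \<le> card V \<Longrightarrow> card E \<le> n \<Longrightarrow> plane_bound V E"
proof (induction "card V" arbitrary: V E rule: less_induct)
  case less
  interpret plane_graph V E \<phi> \<gamma> by fact
  consider "card V = 2" | v where "v \<in> V" "deg v \<le> 2" "card V \<noteq> 2" | "\<And>v. v \<in> V \<Longrightarrow> 2 \<le> deg v" "V \<noteq> {}"
    using less.prems(2) by fastforce
  then show ?case
  proof cases
    case 1
    then show ?thesis by (rule plane_bound_two_vertices)
  next
    case 2
    have "card (V - {v}) = card V - 1" using 2 finite_V by simp
    moreover have "plane_graph (V - {v}) {e \<in> E. v \<notin> e} \<phi> \<gamma>"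
      by (rule plane_subgraph) (use edge in auto)
    moreover have "card {e \<in> E. v \<notin> e} \<le> n"
      using card_mono[of E "{e \<in> E. v \<notin> e}"] finite_E less.prems(3) by auto
    ultimately have "plane_bound (V - {v}) {e \<in> E. v \<notin> e}"
      using less.prems(2) 2(3) by (intro less.hyps) auto
    then show ?thesis by (rule plane_bound_remove_vertex[OF 2(1,2)])
  next
    case 3
    obtain cs where "is_cycle E cs" by (rule cycle_if_min_deg[OF 3(2,1)])
    then show ?thesis by (rule plane_bound_cycle) (use disc less.prems(3) in force)
  qed
qed

lemma plane_disc_bound:
  fixes V :: "'a set"
  assumes "plane_disc V E \<phi> \<gamma> cs"
  shows "disc_bound V E cs"
  using assms
proof (induction "card (E - cycle_edges cs)" arbitrary: V E \<phi> \<gamma> cs rule: less_induct)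
  case less
  show ?case
    by (rule plane_disc.disc_bound_step[OF less.prems less.hyps])
      (use plane_bound_step less.hyps in blast)+
qed

theorem (in plane_graph) plane_graph_bound:
  assumes "2 \<le> card V"
  shows "plane_bound V E"
  by (rule plane_bound_step[OF plane_disc_bound plane_graph_axioms assms]) auto

section \<open>Reducible configurations\<close>

text \<open>
  The vertex \<open>xs ! i\<close> is the \<open>x\<^sub>i\<^sub>+\<^sub>1\<close> of the introduction. When a list of \<open>k\<close> vertices is coloured from
  the last to the first with pairwise distinct colours, \<open>xs ! i\<close> still has \<open>i + 1\<close> of its \<open>k\<close> colours
  left, one of which occurs at most once on its neighbours outside \<open>xs\<close>.
\<close>

definition reducible_list :: "'a set set \<Rightarrow> 'a set \<Rightarrow> 'a list \<Rightarrow> bool" where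
  "reducible_list E W xs \<longleftrightarrow> distinct xs \<and> set xs \<subseteq> W \<and>
     (\<forall>i < length xs. card (neighbours E (xs ! i) \<inter> W - set xs) \<le> 2 * i + 1)"

lemma nth_append3_cases:
  assumes "i < length (bs @ ys @ ts)"
  obtains "i < length bs" "(bs @ ys @ ts) ! i = bs ! i"
  | "length bs \<le> i" "(bs @ ys @ ts) ! i \<in> set ys"
  | j where "j < length ts" "i = length bs + length ys + j" "(bs @ ys @ ts) ! i = ts ! j"
proof -
  consider "i < length bs" | "length bs \<le> i" "i < length bs + length ys" | "length bs + length ys \<le> i"
    by linarith
  then show ?thesis
  proof cases
    case 1
    then show ?thesis by (intro that(1)) (simp_all add: nth_append)
  next
    case 2
    then show ?thesis by (intro that(2)) (auto simp: nth_append)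
  next
    case 3
    then show ?thesis
      using assms by (intro that(3)[of "i - length bs - length ys"]) (auto simp: nth_append)
  qed
qed

lemma reducible_list_induced:
  "reducible_list (induced_edges E W) W xs \<longleftrightarrow> reducible_list E W xs"
proof (cases "set xs \<subseteq> W")
  case True
  then have "neighbours (induced_edges E W) (xs ! i) = neighbours E (xs ! i) \<inter> W"
    if "i < length xs" for i
    using that by (intro neighbours_induced_edges) auto
  then show ?thesis by (simp add: reducible_list_def)
qed (simp add: reducible_list_def)

context simple_graph
begin

lemma reducible_list_V:
  "reducible_list E V xs \<longleftrightarrow> distinct xs \<and> set xs \<subseteq> V \<and>
     (\<forall>i < length xs. card (nbr (xs ! i) - set xs) \<le> 2 * i + 1)"
  using nbr_subset by (simp add: reducible_list_def Int_absorb2)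

lemma degenerate_sequence:
  assumes degenerate: "degenerate E d V" and "n \<le> card (V - Z)"
  shows "\<exists>ys. distinct ys \<and> length ys = n \<and> set ys \<subseteq> V - Z \<and>
    (\<forall>y \<in> set ys. card (nbr y - (Z \<union> set ys)) \<le> d)"
  using assms(2)
proof (induction n)
  case 0
  then show ?case by (intro exI[of _ "[]"]) auto
next
  case (Suc n)
  then obtain ys where ys_low: "distinct ys" "length ys = n" "set ys \<subseteq> V - Z"
    "\<forall>y \<in> set ys. card (nbr y - (Z \<union> set ys)) \<le> d" by auto
  define W where "W = V - Z - set ys"
  have "card W = card (V - Z) - n"
    using ys_low unfolding W_def by (subst card_Diff_subset) (auto simp: distinct_card)
  then have W_nonempty: "W \<subseteq> V" "W \<noteq> {}" using Suc(2) by (auto simp only: W_def card.empty)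
  obtain y where low_y: "y \<in> W" "card (nbr y \<inter> W) \<le> d"
    using degenerate[unfolded degenerate_def, rule_format, OF W_nonempty] by blast
  have "card (nbr x - (Z \<union> set (ys @ [y]))) \<le> d" if x_in: "x \<in> set (ys @ [y])" for x
  proof (cases "x = y")
    case True
    have "card (nbr y - (Z \<union> set (ys @ [y]))) \<le> card (nbr y \<inter> W)"
      using nbr_subset by (intro card_mono) (auto simp: W_def)
    then show ?thesis using True low_y(2) by simp
  next
    case False
    have "card (nbr x - (Z \<union> set (ys @ [y]))) \<le> card (nbr x - (Z \<union> set ys))"
      by (intro card_mono) auto
    also have "\<dots> \<le> d" using ys_low(4) x_in False by simp
    finally show ?thesis .
  qed
  then show ?case
    using ys_low low_y by (intro exI[of _ "ys @ [y]"]) (auto simp: W_def)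
qed

lemma reducible_list_fill:
  assumes degenerate: "degenerate E (2 * length bs + 1) V"
    and k_bounds: "length bs + length ts \<le> k" "k \<le> card V"
    and core: "distinct (bs @ ts)" "set (bs @ ts) \<subseteq> V"
    and bs: "\<And>i. i < length bs \<Longrightarrow> card (nbr (bs ! i) - set (bs @ ts)) \<le> 2 * i + 1"
    and ts: "\<And>j. j < length ts \<Longrightarrow>
      card (nbr (ts ! j) - set (bs @ ts)) \<le> 2 * (k - length ts + j) + 1"
  shows "\<exists>xs. length xs = k \<and> reducible_list E V xs"
proof -
  define n where "n = k - length bs - length ts"
  have "card (V - set (bs @ ts)) = card V - (length bs + length ts)"
    using core distinct_card[OF core(1)] finite_V by (simp add: card_Diff_subset)
  then have "n \<le> card (V - set (bs @ ts))" using k_bounds by (simp add: n_def)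
  then obtain ys where ys: "distinct ys" "length ys = n" "set ys \<subseteq> V - set (bs @ ts)"
    "\<forall>y \<in> set ys. card (nbr y - (set (bs @ ts) \<union> set ys)) \<le> 2 * length bs + 1"
    using degenerate_sequence[OF degenerate] by blast
  define xs where "xs = bs @ ys @ ts"
  have set_xs: "set xs = set (bs @ ts) \<union> set ys" by (auto simp: xs_def)
  have mono: "card (nbr x - set xs) \<le> card (nbr x - set (bs @ ts))" for x
    using set_xs by (intro card_mono) auto
  have len: "length xs = k" using ys(2) k_bounds by (simp add: xs_def n_def)
  have "card (nbr (xs ! i) - set xs) \<le> 2 * i + 1" if i: "i < length xs" for i
    using i[unfolded xs_def]
  proof (cases rule: nth_append3_cases)
    case 1
    then show ?thesis using mono[of "bs ! i"] bs[of i] by (simp add: xs_def)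
  next
    case 2
    then have "card (nbr (xs ! i) - set xs) \<le> 2 * length bs + 1"
      using ys(4) set_xs by (simp add: xs_def)
    then show ?thesis using 2(1) by linarith
  next
    case (3 j)
    have "k - length ts + j = i" using 3(2) ys(2) k_bounds by (simp add: n_def)
    then show ?thesis using mono[of "ts ! j"] ts[OF 3(1)] 3(3) by (simp add: xs_def)
  qed
  then have "reducible_list E V xs"
    unfolding reducible_list_V using len core ys by (auto simp: xs_def)
  then show ?thesis using len by blast
qed

end

section \<open>Degrees and packed triangles\<close>

locale packed_graph = simple_graph V E for V :: "'a set" and E +
  fixes T :: "'a set set"
  assumes packing: "triangle_packing E {} T"
begin

definition triangles_at :: "'a \<Rightarrow> 'a set set" where
  "triangles_at x = {t \<in> T. x \<in> t}"

abbreviation codeg :: "'a \<Rightarrow> 'a \<Rightarrow> nat" where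
  "codeg x y \<equiv> card {t \<in> T. {x, y} \<subseteq> t}"

lemma finite_T: "finite T"
  by (rule triangle_packing_finite[OF packing])

lemma finite_triangles_at [simp]: "finite (triangles_at x)"
  using finite_T by (simp add: triangles_at_def)

lemma T_triangles: "t \<in> T \<Longrightarrow> t \<in> triangles E"
  using triangle_packing_subset_triangles[OF packing] by blast

lemma T_subset_V: "t \<in> T \<Longrightarrow> t \<subseteq> V"
  using triangle_subset_Union[OF T_triangles] Union_E_subset by blast

lemma T_triangleD:
  assumes "{u, v, w} \<in> T"
  shows "u \<noteq> v" "u \<noteq> w" "v \<noteq> w"
    "v \<in> nbr u" "w \<in> nbr u" "u \<in> nbr v" "w \<in> nbr v" "u \<in> nbr w" "v \<in> nbr w"
    "u \<in> V" "v \<in> V" "w \<in> V"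
  using T_triangles[OF assms] T_subset_V[OF assms]
  by (auto simp: insert_in_triangles_iff neighbours_def insert_commute)

lemma codeg_le_2: "y \<in> nbr x \<Longrightarrow> codeg x y \<le> 2"
  using card_packed_triangles_at_edge[OF packing, of "{x, y}"] by (simp add: neighbours_def)

lemma codeg_commute: "codeg x y = codeg y x"
  by (simp add: insert_commute)

lemma sum_codeg: "(\<Sum>y \<in> nbr x. codeg x y) = 2 * card (triangles_at x)"
proof -
  have "card {y \<in> nbr x. y \<in> t} = 2" if t: "t \<in> triangles_at x" for t
  proof -
    have tT: "t \<in> T" "x \<in> t" using t by (auto simp: triangles_at_def)
    then obtain y z where yz: "t = {x, y, z}"
      using triangle_through_vertex[OF T_triangles] by blast
    note yz_nbr = T_triangleD[OF tT(1)[unfolded yz]]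
    have "{y \<in> nbr x. y \<in> t} = {y, z}" using yz yz_nbr nbrD by auto
    then show ?thesis using yz_nbr by simp
  qed
  then have "(\<Sum>y \<in> nbr x. card {t \<in> triangles_at x. y \<in> t}) = 2 * card (triangles_at x)"
    by (intro sum_multicount) auto
  moreover have "{t \<in> triangles_at x. y \<in> t} = {t \<in> T. {x, y} \<subseteq> t}" for y
    by (auto simp: triangles_at_def)
  ultimately show ?thesis by simp
qed

lemma card_triangles_at_codeg_le:
  assumes Y_codeg: "Y \<subseteq> nbr x" "\<And>y. y \<in> Y \<Longrightarrow> codeg x y \<le> c" and "c \<le> 2"
  shows "2 * card (triangles_at x) + (2 - c) * card Y \<le> 2 * deg x"
proof -
  have "2 * card (triangles_at x) = (\<Sum>y \<in> nbr x - Y. codeg x y) + (\<Sum>y \<in> Y. codeg x y)"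
    unfolding sum_codeg[symmetric] using Y_codeg(1) by (intro sum.subset_diff) auto
  also have "\<dots> \<le> (\<Sum>y \<in> nbr x - Y. 2) + (\<Sum>y \<in> Y. c)"
    using Y_codeg(2) codeg_le_2 by (intro add_mono sum_mono) auto
  finally have "2 * card (triangles_at x) + (2 - c) * card Y
      \<le> card (nbr x - Y) * 2 + card Y * (c + (2 - c))"
    by (simp add: distrib_left mult.commute)
  also have "\<dots> = 2 * (card (nbr x - Y) + card Y)" using \<open>c \<le> 2\<close> by simp
  also have "\<dots> \<le> 2 * deg x" using card_nbr_Diff_le[OF Y_codeg(1) order_refl] by simp
  finally show ?thesis .
qed

lemma card_triangles_at_le: "card (triangles_at x) \<le> deg x"
  using card_triangles_at_codeg_le[of "{}" x 2] by simp

lemma card_triangles_at_less: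
  assumes "y \<in> nbr x" "codeg x y \<le> 1"
  shows "card (triangles_at x) < deg x"
  using card_triangles_at_codeg_le[of "{y}" x 1] assms by simp

lemma codeg_le_1_if_common_nbrs:
  assumes "nbr u \<inter> nbr v \<subseteq> {w}" "u \<noteq> v"
  shows "codeg u v \<le> 1"
proof -
  have "t = {u, v, w}" if t_over: "t \<in> T" "{u, v} \<subseteq> t" for t
  proof -
    obtain z where t_eq: "t = {u, v, z}"
      using triangle_through_edge[OF T_triangles[OF t_over(1)], of u v] t_over(2) assms(2) by auto
    then show ?thesis using T_triangleD(5,7)[of u v z] t_over(1) assms(1) by auto
  qed
  then have "codeg u v \<le> card {{u, v, w}}" by (intro card_mono) auto
  then show ?thesis by simp
qed

lemma second_triangle_if_codeg:
  assumes "{u, v, w} \<in> T" "\<not> codeg u v \<le> 1"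
  obtains p where "{u, v, p} \<in> T" "p \<noteq> w"
proof -
  have "\<not> {t \<in> T. {u, v} \<subseteq> t} \<subseteq> {{u, v, w}}"
    using assms(2) card_mono[of "{{u, v, w}}" "{t \<in> T. {u, v} \<subseteq> t}"] by auto
  then obtain t where t_over: "t \<in> T" "u \<in> t" "v \<in> t" "t \<noteq> {u, v, w}" by auto
  obtain p where "t = {u, v, p}"
    using triangle_through_edge[OF T_triangles[OF t_over(1)] t_over(2,3)]
      T_triangleD(1)[OF assms(1)] by blast
  then show ?thesis using that[of p] t_over by auto
qed

lemma card_T_le: "3 * card T \<le> 2 * card E"
proof -
  have "card {e \<in> E. e \<subseteq> t} = 3" if "t \<in> T" for t
  proof -
    have t_triangle: "t \<in> triangles E" "card t = 3"
      using T_triangles[OF that] by (auto simp: triangles_def)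
    then have "{e \<in> E. e \<subseteq> t} = {e. e \<subseteq> t \<and> card e = 2}"
      using edge in_edges_if_subset_triangle by blast
    moreover have "finite t" using t_triangle(2) by (metis card.infinite zero_neq_numeral)
    ultimately show ?thesis
      using n_subsets[of t 2] t_triangle(2) by (simp add: numeral_3_eq_3 numeral_2_eq_2)
  qed
  then have "(\<Sum>e \<in> E. card {t \<in> T. e \<subseteq> t}) = 3 * card T"
    using finite_E finite_T by (intro sum_multicount) auto
  moreover have "(\<Sum>e \<in> E. card {t \<in> T. e \<subseteq> t}) \<le> (\<Sum>e \<in> E. 2)"
    using card_packed_triangles_at_edge[OF packing] by (intro sum_mono) auto
  ultimately show ?thesis by simp
qed

lemma ex_deg_le_5:
  assumes "2 * card E + 6 \<le> card T + 4 * card V"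
  shows "\<exists>x \<in> V. deg x \<le> 5"
proof (rule ccontr)
  assume "\<not> (\<exists>x \<in> V. deg x \<le> 5)"
  then have "(\<Sum>x \<in> V. 6) \<le> (\<Sum>x \<in> V. deg x)" by (intro sum_mono) (auto simp: not_le)
  then show False using assms card_T_le sum_deg by simp
qed

end

lemma (in plane_graph) ex_deg_le_5:
  assumes "V \<noteq> {}"
  shows "\<exists>x \<in> V. deg x \<le> 5"
proof (cases "2 \<le> card V")
  case True
  then obtain T where T_packing: "triangle_packing E {} T" "2 * card E + 6 \<le> card T + 4 * card V"
    using plane_graph_bound by (auto simp: triangle_bound_def)
  interpret packed_graph V E T using T_packing(1) by unfold_locales
  show ?thesis using T_packing(2) by (rule ex_deg_le_5)
next
  case False
  obtain x where "x \<in> V" using assms by auto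
  moreover have "deg x \<le> card V" using nbr_subset finite_V by (rule card_mono[rotated])
  ultimately show ?thesis using False by force
qed

lemma (in plane_graph) degenerate_5: "degenerate E 5 V"
  unfolding degenerate_def
proof (intro allI impI)
  fix A assume A_subset: "A \<subseteq> V" "A \<noteq> {}"
  interpret A: plane_graph A "induced_edges E A" \<phi> \<gamma> by (rule plane_graph_induced[OF A_subset(1)])
  show "\<exists>x \<in> A. card (nbr x \<inter> A) \<le> 5"
    using A.ex_deg_le_5[OF A_subset(2)] by (auto simp: neighbours_induced_edges)
qed

section \<open>Graphs without a reducible configuration\<close>

locale irreducible_graph = packed_graph V E T for V :: "'a set" and E T +
  fixes k :: nat
  assumes k_bounds: "5 \<le> k" "k \<le> card V"
    and max_deg: "x \<in> V \<Longrightarrow> deg x \<le> 2 * k - 1"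
    and degenerate: "degenerate E 5 V"
    and irreducible: "length xs = k \<Longrightarrow> \<not> reducible_list E V xs"
begin

lemma no_core:
  assumes "distinct (u # v # ts)" "set (u # v # ts) \<subseteq> V" "length ts \<le> 3"
    and nbrs_u: "card (nbr u - set (u # v # ts)) \<le> 1"
    and nbrs_v: "card (nbr v - set (u # v # ts)) \<le> 3"
    and "\<And>j. j < length ts \<Longrightarrow>
      card (nbr (ts ! j) - set (u # v # ts)) \<le> 2 * (k - length ts + j) + 1"
  shows False
proof -
  have "card (nbr ([u, v] ! i) - set ([u, v] @ ts)) \<le> 2 * i + 1" if "i < length [u, v]" for i
    using that nbrs_u nbrs_v by (auto simp: less_Suc_eq)
  then show False
    using reducible_list_fill[of "[u, v]" ts k] assms degenerate k_bounds irreducible by auto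
qed

lemma card_nbr_Diff_max: "x \<in> V \<Longrightarrow> card (nbr x - C) \<le> 2 * k - 1"
  using card_nbr_Diff_le[of "{}" x C] max_deg[of x] by simp

text \<open>
  The vertices \<open>u\<close>, \<open>v\<close> take the positions 0, 1 of a reducible list, and \<open>c\<close>, \<open>b\<close>, \<open>a\<close> the last three.
  The sets \<open>U\<close>, \<open>W\<close>, \<open>C\<close>, \<open>B\<close> collect known neighbours of \<open>u\<close>, \<open>v\<close>, \<open>c\<close>, \<open>b\<close> inside the configuration.
\<close>

lemma no_five_vertex_core:
  assumes core: "distinct [a, b, c, v, u]" "{u, v, c, b, a} \<subseteq> V"
    and nbrs_b: "B \<subseteq> nbr b \<inter> {u, v, c, b, a}" "deg b + 3 \<le> 2 * k + card B"
    and nbrs_c: "C \<subseteq> nbr c \<inter> {u, v, c, b, a}" "deg c + 5 \<le> 2 * k + card C"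
    and nbrs_v: "W \<subseteq> nbr v \<inter> {u, v, c, b, a}" "deg v \<le> 3 + card W"
    and nbrs_u: "U \<subseteq> nbr u \<inter> {u, v, c, b, a}" "deg u \<le> 1 + card U"
  shows False
proof (rule no_core[of u v "[c, b, a]"])
  let ?S = "set (u # v # [c, b, a])"
  show "card (nbr u - ?S) \<le> 1" using card_nbr_Diff_le[of U u ?S] nbrs_u by auto
  show "card (nbr v - ?S) \<le> 3" using card_nbr_Diff_le[of W v ?S] nbrs_v by auto
  fix j assume "j < length [c, b, a]"
  then consider "j = 0" | "j = 1" | "j = 2" by force
  then show "card (nbr ([c, b, a] ! j) - ?S) \<le> 2 * (k - length [c, b, a] + j) + 1"
  proof cases
    case 1
    then show ?thesis using card_nbr_Diff_le[of C c ?S] nbrs_c k_bounds by force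
  next
    case 2
    then show ?thesis using card_nbr_Diff_le[of B b ?S] nbrs_b k_bounds by force
  next
    case 3
    then show ?thesis using card_nbr_Diff_max[of a ?S] core k_bounds by simp
  qed
qed (use core in auto)

lemma no_four_vertex_core:
  assumes core: "distinct [a, b, v, u]" "{u, v, b, a} \<subseteq> V"
    and nbrs_b: "B \<subseteq> nbr b \<inter> {u, v, b, a}" "deg b + 3 \<le> 2 * k + card B"
    and nbrs_v: "W \<subseteq> nbr v \<inter> {u, v, b, a}" "deg v \<le> 3 + card W"
    and nbrs_u: "U \<subseteq> nbr u \<inter> {u, v, b, a}" "deg u \<le> 1 + card U"
  shows False
proof (rule no_core[of u v "[b, a]"])
  let ?S = "set (u # v # [b, a])"
  show "card (nbr u - ?S) \<le> 1" using card_nbr_Diff_le[of U u ?S] nbrs_u by auto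
  show "card (nbr v - ?S) \<le> 3" using card_nbr_Diff_le[of W v ?S] nbrs_v by auto
  fix j assume "j < length [b, a]"
  then consider "j = 0" | "j = 1" by force
  then show "card (nbr ([b, a] ! j) - ?S) \<le> 2 * (k - length [b, a] + j) + 1"
  proof cases
    case 1
    then show ?thesis using card_nbr_Diff_le[of B b ?S] nbrs_b k_bounds by force
  next
    case 2
    then show ?thesis using card_nbr_Diff_max[of a ?S] core k_bounds by simp
  qed
qed (use core in auto)

lemma deg4_triangle_deg_ge_6:
  assumes uvw: "{u, v, w} \<in> T" and deg_u: "deg u = 4"
  shows "6 \<le> deg v"
proof (rule ccontr)
  assume deg_v: "\<not> 6 \<le> deg v"
  note tri = T_triangleD[OF uvw]
  obtain p where p_nbr: "p \<in> nbr u" "p \<notin> {v, w}"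
    using ex_nbr_notin[of "{v, w}" u] deg_u tri by auto
  have "p \<in> V" "p \<noteq> u" using nbrD[OF p_nbr(1)] by auto
  then show False
    using tri p_nbr deg_v deg_u max_deg[of w] k_bounds
    by (intro no_four_vertex_core[of p w v u "{u, v}" "{u, w}" "{v, w, p}"]) auto
qed

lemma deg4_deg6_common_nbrs:
  assumes uvw: "{u, v, w} \<in> T" and deg_u: "deg u = 4" and deg_v: "deg v = 6"
  shows "nbr u \<inter> nbr v \<subseteq> {w}"
proof (rule ccontr)
  assume "\<not> nbr u \<inter> nbr v \<subseteq> {w}"
  then obtain p where p_nbr: "p \<in> nbr u" "p \<in> nbr v" "p \<noteq> w" by auto
  note tri = T_triangleD[OF uvw]
  have "p \<in> V" "p \<noteq> u" "p \<noteq> v" using nbrD[OF p_nbr(1)] nbrD[OF p_nbr(2)] by auto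
  then show False
    using tri p_nbr deg_v deg_u max_deg[of w] k_bounds
    by (intro no_four_vertex_core[of p w v u "{u, v}" "{u, w, p}" "{v, w, p}"]) auto
qed

lemma deg4_deg6_low_nbr:
  assumes uvw: "{u, v, w} \<in> T" and deg_u: "deg u = 4" and deg_v: "deg v = 6"
    and low_s: "s \<in> nbr v" "deg s \<le> 5"
  shows "s = u"
proof (rule ccontr)
  assume s_neq_u: "s \<noteq> u"
  note tri = T_triangleD[OF uvw]
  have "6 \<le> deg w" using deg4_triangle_deg_ge_6[of u w v] uvw deg_u by (simp add: insert_commute)
  then have s_neq_w: "s \<noteq> w" using low_s by auto
  then have s_not_nbr: "s \<notin> nbr u" using deg4_deg6_common_nbrs[OF uvw deg_u deg_v] low_s by auto
  obtain c where c_nbr: "c \<in> nbr u" "c \<notin> {v, w}"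
    using ex_nbr_notin[of "{v, w}" u] deg_u tri by auto
  have "c \<in> V" "c \<noteq> u" "s \<in> V" "s \<noteq> v" using nbrD[OF c_nbr(1)] nbrD[OF low_s(1)] by auto
  then show False
    using tri c_nbr low_s s_neq_w s_neq_u s_not_nbr deg_v deg_u max_deg[of w] k_bounds
    by (intro no_five_vertex_core[of c w s v u "{u, v}" "{}" "{u, w, s}" "{v, w, c}"]) auto
qed

lemma deg4_deg7_low_nbr:
  assumes uvw: "{u, v, w} \<in> T" "{u, v, p} \<in> T" "p \<noteq> w" and deg_u: "deg u = 4"
    and deg_v: "deg v = 7"
    and low_s: "s \<in> nbr v" "deg s \<le> 5"
  shows "s = u"
proof (rule ccontr)
  assume s_neq_u: "s \<noteq> u"
  note tri = T_triangleD[OF uvw(1)] T_triangleD[OF uvw(2)]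
  have "6 \<le> deg w" "6 \<le> deg p"
    using deg4_triangle_deg_ge_6[of u w v] deg4_triangle_deg_ge_6[of u p v] uvw deg_u
    by (simp_all add: insert_commute)
  then have s_neq_w: "s \<noteq> w" "s \<noteq> p" using low_s by auto
  have "s \<in> V" "s \<noteq> v" using nbrD[OF low_s(1)] by auto
  then show False
    using tri low_s s_neq_w s_neq_u deg_v deg_u uvw(3) max_deg[of w] k_bounds
    by (intro no_five_vertex_core[of p w s v u "{u, v}" "{}" "{u, w, p, s}" "{v, w, p}"]) auto
qed

lemma deg5_deg6_common_nbrs:
  assumes uvw: "{u, v, w} \<in> T" and deg_u: "deg u = 5" and deg_v: "deg v = 6"
    and deg_w: "deg w \<le> 7"
  shows "nbr u \<inter> nbr v \<subseteq> {w}"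
proof (rule ccontr)
  assume "\<not> nbr u \<inter> nbr v \<subseteq> {w}"
  then obtain p where p_nbr: "p \<in> nbr u" "p \<in> nbr v" "p \<noteq> w" by auto
  note tri = T_triangleD[OF uvw]
  have p_V: "p \<in> V" "p \<noteq> u" "p \<noteq> v" "u \<in> nbr p" "v \<in> nbr p"
    using nbrD[OF p_nbr(1)] nbrD[OF p_nbr(2)] neighbours_sym p_nbr by fast+
  obtain c where c_nbr: "c \<in> nbr u" "c \<notin> {v, w, p}"
    using ex_nbr_notin[of "{v, w, p}" u] deg_u tri p_nbr p_V by auto
  have "c \<in> V" "c \<noteq> u" using nbrD[OF c_nbr(1)] by auto
  then show False
    using tri p_nbr c_nbr p_V deg_v deg_u deg_w max_deg[of p] k_bounds
    by (intro no_five_vertex_core[of c p w v u "{u, v}" "{u, v}" "{u, w, p}" "{v, w, p, c}"]) auto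
qed

lemma deg5_deg5_nbrs_nonadjacent:
  assumes uvw: "{u, v, w} \<in> T" and deg_u: "deg u = 5" and deg_v: "deg v = 5"
    and deg_w: "deg w \<le> 7"
    and a_nbr: "a \<in> nbr u" "a \<notin> {v, w}" and b_nbr: "b \<in> nbr u" "b \<notin> {v, w, a}"
    and x_cases: "x \<in> {v, w, b}"
  shows "x \<notin> nbr a"
proof
  assume x_nbr: "x \<in> nbr a"
  note tri = T_triangleD[OF uvw]
  have ab_V: "b \<in> V" "b \<noteq> u" "a \<in> V" "a \<noteq> u" "u \<in> nbr a"
    using nbrD[OF b_nbr(1)] nbrD[OF a_nbr(1)] neighbours_sym a_nbr by fast+
  then have "card {u, x} = 2" using x_cases tri by auto
  then show False
    using tri a_nbr b_nbr x_cases x_nbr ab_V deg_v deg_u deg_w max_deg[of a] k_bounds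
    by (intro no_five_vertex_core[of b a w v u "{u, x}" "{u, v}" "{u, w}" "{v, w, b, a}"]) auto
qed

lemma deg5_deg5_triangles_at:
  assumes uvw: "{u, v, w} \<in> T" and deg_u: "deg u = 5" and deg_v: "deg v = 5"
    and deg_w: "deg w \<le> 7"
  shows "triangles_at u = {{u, v, w}}"
proof -
  note nonadjacent = deg5_deg5_nbrs_nonadjacent[OF uvw deg_u deg_v deg_w]
  have False if ab: "{u, a, b} \<in> T" "a \<notin> {v, w}" for a b
  proof (cases "b \<in> {v, w}")
    case True
    obtain c where "c \<in> nbr u" "c \<notin> {v, w, a}"
      by (rule ex_nbr_notin[of "{v, w, a}" u]) (use deg_u in \<open>auto simp: card_insert_if\<close>)
    then show False using nonadjacent[of a c b] T_triangleD[OF ab(1)] ab(2) True by auto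
  next
    case False
    then show False using nonadjacent[of a b b] T_triangleD[OF ab(1)] ab(2) by auto
  qed
  then have only: "a \<in> {v, w} \<and> b \<in> {v, w}" if "{u, a, b} \<in> T" for a b
    using that by (metis insert_commute)
  show ?thesis
  proof (intro equalityI subsetI)
    fix t' assume "t' \<in> triangles_at u"
    then have t': "t' \<in> T" "u \<in> t'" by (simp_all add: triangles_at_def)
    obtain a b where ab: "t' = {u, a, b}"
      by (rule triangle_through_vertex[OF T_triangles[OF t'(1)] t'(2)])
    then show "t' \<in> {{u, v, w}}" using only[of a b] T_triangleD(3)[of u a b] t'(1) by auto
  qed (use uvw in \<open>simp add: triangles_at_def\<close>)
qed

lemma deg5_deg5_next_deg_ge_8:
  assumes uvw: "{u, v, w} \<in> T" and deg_u: "deg u = 5" and deg_v: "deg v = 5"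
    and next_triangle: "{u, w, y} \<in> T" "y \<noteq> v"
  shows "8 \<le> deg y"
proof (rule ccontr)
  assume deg_y: "\<not> 8 \<le> deg y"
  note tri = T_triangleD[OF uvw] T_triangleD[OF next_triangle(1)]
  obtain c where c_nbr: "c \<in> nbr u" "c \<notin> {v, w, y}"
    using ex_nbr_notin[of "{v, w, y}" u] deg_u tri next_triangle by auto
  have "c \<in> V" "c \<noteq> u" using nbrD[OF c_nbr(1)] by auto
  then show False
    using tri c_nbr deg_v deg_u next_triangle deg_y max_deg[of w] k_bounds
    by (intro no_five_vertex_core[of c w y v u "{u, v, y}" "{u, w}" "{u, w}" "{v, w, y, c}"]) auto
qed

lemma two_deg3_card_nbr_ge_3:
  assumes uv: "u \<in> V" "v \<in> V" "u \<noteq> v" "deg u \<le> 3" "deg v \<le> 3"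
  shows "3 \<le> card (nbr u - {v})"
proof (rule ccontr)
  assume "\<not> 3 \<le> card (nbr u - {v})"
  then have few: "card (nbr u - {v}) \<le> 2" by simp
  show False
  proof (cases "nbr u - {v} = {}")
    case True
    then have "nbr u - {u, v} = {}" by auto
    then have "card (nbr u - {u, v}) \<le> 1" by (simp only: card.empty)
    then show False
      using uv card_nbr_Diff_le[of "{}" v "set [u, v]"] by (intro no_core[of u v "[]"]) auto
  next
    case False
    then obtain a where a_nbr: "a \<in> nbr u" "a \<noteq> v" by auto
    have "card (nbr u - set [u, v, a]) \<le> card (nbr u - {v} - {a})" by (intro card_mono) auto
    also have "\<dots> \<le> 1" using few a_nbr by simp
    finally show False
      using uv nbrD[OF a_nbr(1)] a_nbr card_nbr_Diff_le[of "{}" v "set [u, v, a]"]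
        card_nbr_Diff_max[of a "set [u, v, a]"] k_bounds
      by (intro no_core[of u v "[a]"]) auto
  qed
qed

lemma two_deg3_nbrs:
  assumes uv: "u \<in> V" "v \<in> V" "u \<noteq> v" "deg u \<le> 3" "deg v \<le> 3"
    and ab_nbrs: "a \<in> nbr u" "b \<in> nbr u" "a \<noteq> b"
  shows "deg b = 2 * k - 1" "a \<notin> nbr b"
proof -
  have "card (nbr u - {v}) \<le> deg u" by (intro card_mono) auto
  then have deg_u: "deg u = 3" "v \<notin> nbr u"
    using two_deg3_card_nbr_ge_3[OF uv] uv(4) card_Diff_singleton[of v "nbr u"]
    by (fastforce split: if_splits)+
  have ab_V: "a \<in> V" "a \<noteq> u" "b \<in> V" "b \<noteq> u" "u \<in> nbr b" "a \<noteq> v" "b \<noteq> v"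
    using nbrD[OF ab_nbrs(1)] nbrD[OF ab_nbrs(2)] neighbours_sym[of b] ab_nbrs deg_u(2) by auto
  have False if "B \<subseteq> nbr b \<inter> {a, u}" "deg b + 3 \<le> 2 * k + card B" for B
    using that ab_V ab_nbrs uv deg_u
    by (intro no_four_vertex_core[of a b v u B "{}" "{a, b}"]) auto
  from this[of "{u}"] this[of "{a, u}"]
  have "\<not> deg b + 3 \<le> 2 * k + 1" "a \<notin> nbr b \<or> \<not> deg b + 3 \<le> 2 * k + 2" using ab_V by auto
  then show "deg b = 2 * k - 1" "a \<notin> nbr b" using max_deg[OF ab_V(3)] k_bounds by linarith+
qed

lemma two_deg3:
  assumes uv: "u \<in> V" "v \<in> V" "u \<noteq> v" "deg u \<le> 3" "deg v \<le> 3"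
  shows "deg u = 3" "triangles_at u = {}" "\<And>b. b \<in> nbr u \<Longrightarrow> deg b = 2 * k - 1"
proof -
  have "card (nbr u - {v}) \<le> deg u" by (intro card_mono) auto
  then show deg_u: "deg u = 3" using two_deg3_card_nbr_ge_3[OF uv] uv(4) by simp
  show "deg b = 2 * k - 1" if b_nbr: "b \<in> nbr u" for b
  proof -
    obtain a where "a \<in> nbr u" "a \<notin> {b}" using ex_nbr_notin[of "{b}" u] deg_u by auto
    then show ?thesis using two_deg3_nbrs(1)[OF uv, of a b] b_nbr by auto
  qed
  have False if t_at_u: "t \<in> T" "u \<in> t" for t
  proof -
    obtain a b where "t = {u, a, b}"
      by (rule triangle_through_vertex[OF T_triangles[OF t_at_u(1)] t_at_u(2)])
    then have "{u, a, b} \<in> T" using t_at_u(1) by simp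
    from T_triangleD[OF this] show False using two_deg3_nbrs(2)[OF uv, of a b] by auto
  qed
  then show "triangles_at u = {}" by (auto simp: triangles_at_def)
qed

end

section \<open>Discharging\<close>

lemma sort_three:
  fixes f :: "'b \<Rightarrow> nat"
  obtains u v w where "{x, y, z} = {u, v, w}" "f u \<le> f v" "f v \<le> f w"
proof -
  consider "f x \<le> f y" "f y \<le> f z" | "f x \<le> f z" "f z \<le> f y" | "f y \<le> f x" "f x \<le> f z"
    | "f y \<le> f z" "f z \<le> f x" | "f z \<le> f x" "f x \<le> f y" | "f z \<le> f y" "f y \<le> f x" by linarith
  then show ?thesis
    by cases (use that in \<open>auto simp: insert_commute\<close>)
qed

context packed_graph
begin

definition low :: "'a set \<Rightarrow> bool" where
  "low t \<longleftrightarrow> (\<exists>y \<in> t. deg y \<le> 5)"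

definition num_low :: "'a \<Rightarrow> nat" where
  "num_low x = card {t \<in> triangles_at x. low t}"

definition num_high :: "'a \<Rightarrow> nat" where
  "num_high x = card {t \<in> triangles_at x. \<not> low t}"

definition needy :: "'a \<Rightarrow> 'a set \<Rightarrow> bool" where
  "needy x t \<longleftrightarrow> (\<exists>y \<in> t. y \<noteq> x \<and> deg y \<le> 7)"

definition num_needy :: "'a \<Rightarrow> nat" where
  "num_needy x = card {t \<in> triangles_at x. needy x t}"

text \<open>
  The part of its charge \<open>deg x - 4\<close> that the vertex \<open>x\<close> passes on to the triangle
  \<open>t \<in> triangles_at x\<close>; every triangle has to collect 1. No division by 0 occurs, since \<open>t\<close> itself is
  counted in \<open>num_low x\<close> or \<open>num_needy x\<close>.
\<close>

definition weight :: "'a \<Rightarrow> 'a set \<Rightarrow> real" where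
  "weight x t =
     (if 8 \<le> deg x then 1 / 2
      else if 6 \<le> deg x then
        (if low t then (real (deg x) - 4 - real (num_high x) / 3) / real (num_low x) else 1 / 3)
      else if deg x = 5 \<and> needy x t then 1 / real (num_needy x)
      else 0)"

lemma num_low_add_high: "num_low x + num_high x = card (triangles_at x)"
proof -
  have "triangles_at x = {t \<in> triangles_at x. low t} \<union> {t \<in> triangles_at x. \<not> low t}" by auto
  also have "card \<dots> = num_low x + num_high x"
    unfolding num_low_def num_high_def by (intro card_Un_disjoint) auto
  finally show ?thesis by simp
qed

lemma num_low_pos: "t \<in> triangles_at x \<Longrightarrow> low t \<Longrightarrow> 1 \<le> num_low x"
  unfolding num_low_def by (auto simp: Suc_le_eq card_gt_0_iff)

lemma num_needy_le: "num_needy x \<le> card (triangles_at x)"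
  unfolding num_needy_def by (intro card_mono) auto

lemma weight_low_ge:
  assumes "t \<in> triangles_at x" "low t" "deg x = 6 \<or> deg x = 7" "card (triangles_at x) \<le> n"
  shows "weight x t \<ge> (3 * real (deg x) - 12 - real n + real (num_low x)) / (3 * real (num_low x))"
proof -
  have low: "1 \<le> num_low x" using num_low_pos assms by auto
  have "real (num_high x) \<le> real n - real (num_low x)"
    using num_low_add_high[of x] assms(4) by linarith
  then have "(3 * real (deg x) - 12 - real n + real (num_low x)) / (3 * real (num_low x)) \<le>
    (3 * real (deg x) - 12 - real (num_high x)) / (3 * real (num_low x))"
    using low by (intro divide_right_mono) auto
  also have "\<dots> = weight x t" using low assms(2,3) by (auto simp: weight_def field_simps)
  finally show ?thesis .
qed

lemma weight_deg6_ge: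
  assumes "t \<in> triangles_at x" "low t" "deg x = 6"
  shows "weight x t \<ge> 1 / 3"
  using weight_low_ge[of t x 6] card_triangles_at_le[of x] num_low_pos[of t x] assms
  by (simp add: field_simps)

lemma weight_deg6_few_triangles_ge:
  assumes low_t: "t \<in> triangles_at x" "low t" and "deg x = 6" "card (triangles_at x) \<le> 5"
  shows "weight x t \<ge> 2 / 5"
proof -
  have "num_low x \<le> 5" "1 \<le> num_low x"
    using assms num_low_add_high[of x] num_low_pos[OF low_t] by auto
  then have "(3 * real (deg x) - 12 - real 5 + real (num_low x)) / (3 * real (num_low x)) \<ge> 2 / 5"
    using assms by (simp add: field_simps)
  then show ?thesis using weight_low_ge[of t x 5] assms by linarith
qed

lemma weight_deg7_ge:
  assumes low_t: "t \<in> triangles_at x" "low t" and "deg x = 7"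
  shows "weight x t \<ge> 3 / 7"
proof -
  have "num_low x \<le> 7" "1 \<le> num_low x"
    using assms num_low_add_high[of x] num_low_pos[OF low_t] card_triangles_at_le[of x] by auto
  then have "(3 * real (deg x) - 12 - real 7 + real (num_low x)) / (3 * real (num_low x)) \<ge> 3 / 7"
    using assms by (simp add: field_simps)
  then show ?thesis using weight_low_ge[of t x 7] assms card_triangles_at_le[of x] by linarith
qed

lemma weight_deg8: "8 \<le> deg x \<Longrightarrow> weight x t = 1 / 2"
  by (simp add: weight_def)

lemma weight_ge_third:
  assumes t_at_x: "t \<in> triangles_at x" and "6 \<le> deg x"
  shows "weight x t \<ge> 1 / 3"
proof (cases "8 \<le> deg x \<or> \<not> low t")
  case True
  then show ?thesis using assms by (auto simp: weight_def)
next
  case False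
  then consider "deg x = 6" | "deg x = 7" using assms by linarith
  then show ?thesis
    using weight_deg6_ge[OF t_at_x] weight_deg7_ge[OF t_at_x] False by cases linarith+
qed

lemma weight_nonneg: "t \<in> triangles_at x \<Longrightarrow> weight x t \<ge> 0"
  using weight_ge_third[of t x] by (cases "6 \<le> deg x") (auto simp: weight_def)

lemma weight_deg5_ge:
  assumes "t \<in> triangles_at x" "deg x = 5" "needy x t" "num_needy x \<le> n"
  shows "weight x t \<ge> 1 / real n"
proof -
  have "0 < num_needy x" using assms unfolding num_needy_def by (auto simp: card_gt_0_iff)
  then show ?thesis using assms by (simp add: weight_def frac_le)
qed

lemma sum_weight_deg5:
  assumes "deg x = 5"
  shows "(\<Sum>t \<in> triangles_at x. weight x t) \<le> 1"
proof -
  have "(\<Sum>t \<in> triangles_at x. weight x t)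
      = (\<Sum>t \<in> triangles_at x. if needy x t then 1 / real (num_needy x) else 0)"
    using assms by (simp add: weight_def)
  also have "\<dots> = (\<Sum>t \<in> {t \<in> triangles_at x. needy x t}. 1 / real (num_needy x))"
    by (rule sum.inter_filter[symmetric]) simp
  also have "\<dots> = real (num_needy x) / real (num_needy x)" by (simp add: num_needy_def)
  also have "\<dots> \<le> 1" by simp
  finally show ?thesis .
qed

lemma sum_weight_deg6_deg7:
  assumes deg_x: "deg x = 6 \<or> deg x = 7"
  shows "(\<Sum>t \<in> triangles_at x. weight x t) \<le> real (deg x) - 4"
proof -
  let ?low = "{t \<in> triangles_at x. low t}" and ?high = "{t \<in> triangles_at x. \<not> low t}"
  let ?share = "(real (deg x) - 4 - real (num_high x) / 3) / real (num_low x)"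
  have "(\<Sum>t \<in> triangles_at x. weight x t) = (\<Sum>t \<in> ?low. weight x t) + (\<Sum>t \<in> ?high. weight x t)"
    by (subst sum.union_disjoint[symmetric]) (auto intro: sum.cong)
  also have "(\<Sum>t \<in> ?high. weight x t) = (\<Sum>t \<in> ?high. 1 / 3)"
    using deg_x by (intro sum.cong refl) (auto simp: weight_def)
  also have "\<dots> = real (num_high x) / 3" by (simp add: num_high_def)
  also have "(\<Sum>t \<in> ?low. weight x t) = (\<Sum>t \<in> ?low. ?share)"
    using deg_x by (intro sum.cong refl) (auto simp: weight_def)
  also have "\<dots> = real (num_low x) * ?share"
    unfolding num_low_def by (simp only: sum_constant)
  finally have total: "(\<Sum>t \<in> triangles_at x. weight x t)
      = real (num_low x) * ?share + real (num_high x) / 3" .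
  show ?thesis
  proof (cases "num_low x = 0")
    case True
    then have "real (num_high x) \<le> real (deg x)"
      using num_low_add_high[of x] card_triangles_at_le[of x] by linarith
    then show ?thesis using total True deg_x by auto
  next
    case False
    then show ?thesis using total by simp
  qed
qed

lemma sum_weight_le:
  assumes deg_x: "4 \<le> deg x"
    and Y_codeg: "Y \<subseteq> nbr x" "\<And>y. y \<in> Y \<Longrightarrow> codeg x y = 0" "8 \<le> deg x \<or> Y = {}"
  shows "(\<Sum>t \<in> triangles_at x. weight x t) + real (card Y) / 2 \<le> real (deg x) - 4"
proof -
  consider "8 \<le> deg x" | "deg x = 6 \<or> deg x = 7" "Y = {}" | "deg x = 5" "Y = {}" | "deg x = 4" "Y = {}"
    using deg_x Y_codeg(3) by linarith
  then show ?thesis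
  proof cases
    case 1
    have "2 * card (triangles_at x) + 2 * card Y \<le> 2 * deg x"
      using card_triangles_at_codeg_le[of Y x 0] Y_codeg(1,2) by simp
    then show ?thesis using 1 by (simp add: weight_deg8)
  next
    case 2
    then show ?thesis using sum_weight_deg6_deg7[of x] by simp
  next
    case 3
    then show ?thesis using sum_weight_deg5[of x] by simp
  next
    case 4
    then show ?thesis by (simp add: weight_def)
  qed
qed

lemma low_triangleI:
  assumes "{u, v, w} \<in> T" "deg u \<le> 5"
  shows "low {u, v, w}"
  using assms by (auto simp: low_def)

lemma in_triangles_at:
  assumes "{u, v, w} \<in> T"
  shows "{u, v, w} \<in> triangles_at u" "{u, v, w} \<in> triangles_at v" "{u, v, w} \<in> triangles_at w"
  using assms by (auto simp: triangles_at_def)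

lemma num_low_le_codeg:
  assumes "6 \<le> deg v" and only: "\<And>s. s \<in> nbr v \<Longrightarrow> deg s \<le> 5 \<Longrightarrow> s = u"
  shows "num_low v \<le> codeg u v"
proof -
  have "{u, v} \<subseteq> t" if low_t: "t \<in> T" "v \<in> t" "low t" for t
  proof -
    obtain s where low_s: "s \<in> t" "deg s \<le> 5" using low_t(3) by (auto simp: low_def)
    then have "v \<noteq> s" using assms(1) by auto
    then obtain z where "t = {v, s, z}"
      using triangle_through_edge[OF T_triangles[OF low_t(1)] low_t(2) low_s(1)] by blast
    then have "s \<in> nbr v" using low_t(1) T_triangleD(4) by blast
    then show ?thesis using only low_s low_t(2) by auto
  qed
  then show ?thesis
    unfolding num_low_def triangles_at_def using finite_T by (intro card_mono) auto
qed

end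

context irreducible_graph
begin

lemma weight_deg4_deg6:
  assumes uvw: "{u, v, w} \<in> T" and deg_u: "deg u = 4" and deg_v: "deg v = 6"
  shows "weight v {u, v, w} \<ge> 2 / 3"
proof -
  note tri = T_triangleD[OF uvw]
  have low: "low {u, v, w}" using low_triangleI[OF uvw] deg_u by simp
  have codeg: "codeg u v \<le> 1"
    using codeg_le_1_if_common_nbrs[OF deg4_deg6_common_nbrs[OF uvw deg_u deg_v]] tri by simp
  have "num_low v \<le> codeg u v"
    by (rule num_low_le_codeg) (use deg4_deg6_low_nbr[OF uvw deg_u deg_v] deg_v in simp_all)
  then have one: "num_low v = 1"
    using codeg num_low_pos[OF in_triangles_at(2)[OF uvw] low] by linarith
  have "card (triangles_at v) \<le> 5"
    using card_triangles_at_less[of u v] codeg codeg_commute[of u v] tri deg_v by simp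
  then have "weight v {u, v, w}
      \<ge> (3 * real (deg v) - 12 - real 5 + real (num_low v)) / (3 * real (num_low v))"
    using in_triangles_at[OF uvw] low deg_v by (intro weight_low_ge) simp_all
  then show ?thesis using one deg_v by simp
qed

lemma weight_deg4_deg7:
  assumes uvw: "{u, v, w} \<in> T" and deg_u: "deg u = 4" and deg_v: "deg v = 7"
  shows "weight v {u, v, w} \<ge> 1 / 2"
proof -
  note tri = T_triangleD[OF uvw]
  have low: "low {u, v, w}" using low_triangleI[OF uvw] deg_u by simp
  have pos: "1 \<le> num_low v" by (rule num_low_pos[OF in_triangles_at(2)[OF uvw] low])
  obtain n where n_bound: "card (triangles_at v) \<le> n" "2 * n + num_low v \<le> 18"
  proof (cases "codeg u v \<le> 1")
    case True
    then have "card (triangles_at v) \<le> 6"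
      using card_triangles_at_less[of u v] codeg_commute[of u v] tri deg_v by simp
    then show ?thesis using that[of 6] num_low_add_high[of v] by simp
  next
    case False
    then obtain p where second_triangle: "{u, v, p} \<in> T" "p \<noteq> w"
      by (rule second_triangle_if_codeg[OF uvw])
    have "num_low v \<le> codeg u v"
      by (rule num_low_le_codeg)
        (use deg4_deg7_low_nbr[OF uvw second_triangle deg_u deg_v] deg_v in simp_all)
    also have "\<dots> \<le> 2" using codeg_le_2 tri by simp
    finally show ?thesis using that[of 7] card_triangles_at_le[of v] deg_v by simp
  qed
  have "1 / 2 \<le> (3 * real (deg v) - 12 - real n + real (num_low v)) / (3 * real (num_low v))"
    using n_bound(2) pos deg_v by (simp add: field_simps)
  also have "\<dots> \<le> weight v {u, v, w}"
    using in_triangles_at[OF uvw] low deg_v n_bound(1) by (intro weight_low_ge) simp_all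
  finally show ?thesis .
qed

lemma weight_deg5_deg5:
  assumes uvw: "{u, v, w} \<in> T" and deg_u: "deg u = 5" and deg_v: "deg v = 5"
    and deg_w: "8 \<le> deg w"
  shows "weight u {u, v, w} \<ge> 1 / 4"
proof -
  note tri = T_triangleD[OF uvw]
  have "num_needy u \<le> 4"
  proof (rule ccontr)
    assume "\<not> num_needy u \<le> 4"
    then have five: "5 \<le> num_needy u" "5 \<le> card (triangles_at u)"
      using num_needy_le[of u] by linarith+
    have "\<not> codeg u w \<le> 1" using card_triangles_at_less[of w u] tri deg_u five by auto
    then obtain y where next_triangle: "{u, w, y} \<in> T" "y \<noteq> v"
      using second_triangle_if_codeg[of u w v] uvw by (auto simp: insert_commute)
    have "8 \<le> deg y" by (rule deg5_deg5_next_deg_ge_8[OF uvw deg_u deg_v next_triangle])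
    then have "\<not> needy u {u, w, y}" using deg_w by (auto simp: needy_def)
    then have "{t \<in> triangles_at u. needy u t} \<subset> triangles_at u"
      using in_triangles_at[OF next_triangle(1)] by auto
    then have "num_needy u < card (triangles_at u)"
      unfolding num_needy_def by (intro psubset_card_mono) auto
    then show False using card_triangles_at_le[of u] deg_u five by simp
  qed
  moreover have "needy u {u, v, w}" using deg_v tri by (auto simp: needy_def)
  ultimately show ?thesis
    using weight_deg5_ge[of "{u, v, w}" u 4] in_triangles_at[OF uvw] deg_u by simp
qed

lemma triangle_weight_deg4:
  assumes uvw: "{u, v, w} \<in> T" and deg_u: "deg u = 4" and deg_le: "deg v \<le> deg w"
  shows "weight u {u, v, w} + weight v {u, v, w} + weight w {u, v, w} \<ge> 1"
proof -
  have swapped: "{u, w, v} \<in> T" "{u, w, v} = {u, v, w}" using uvw by (auto simp: insert_commute)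
  note at = in_triangles_at[OF uvw]
  have "6 \<le> deg v" using deg4_triangle_deg_ge_6[OF uvw deg_u] .
  then consider "deg v = 6" "6 \<le> deg w" | "7 \<le> deg v" "7 \<le> deg w" using deg_le by linarith
  then show ?thesis
  proof cases
    case 1
    then show ?thesis
      using weight_deg4_deg6[OF uvw deg_u] weight_ge_third[OF at(3)] weight_nonneg[OF at(1)]
      by linarith
  next
    case 2
    have "weight v {u, v, w} \<ge> 1 / 2"
      using weight_deg4_deg7[OF uvw deg_u] weight_deg8[of v] 2(1) by (cases "deg v = 7") auto
    moreover have "weight w {u, v, w} \<ge> 1 / 2"
      using weight_deg4_deg7[OF swapped(1) deg_u] weight_deg8[of w] 2(2) unfolding swapped(2)
      by (cases "deg w = 7") auto
    ultimately show ?thesis using weight_nonneg[OF at(1)] by linarith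
  qed
qed

lemma triangle_weight_deg5_deg5:
  assumes uvw: "{u, v, w} \<in> T" and deg_u: "deg u = 5" and deg_v: "deg v = 5"
  shows "weight u {u, v, w} + weight v {u, v, w} + weight w {u, v, w} \<ge> 1"
proof (cases "deg w \<le> 7")
  case True
  note at = in_triangles_at[OF uvw]
  have "triangles_at u = {{u, v, w}}" by (rule deg5_deg5_triangles_at[OF uvw deg_u deg_v True])
  then have "num_needy u \<le> 1" using num_needy_le[of u] by simp
  moreover have "needy u {u, v, w}" using deg_v T_triangleD[OF uvw] by (auto simp: needy_def)
  ultimately have "weight u {u, v, w} \<ge> 1"
    using weight_deg5_ge[of "{u, v, w}" u 1] at deg_u by simp
  then show ?thesis using weight_nonneg[OF at(2)] weight_nonneg[OF at(3)] by linarith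
next
  case False
  have swapped: "{v, u, w} \<in> T" "{v, u, w} = {u, v, w}" using uvw by (auto simp: insert_commute)
  have "weight u {u, v, w} \<ge> 1 / 4" "weight v {u, v, w} \<ge> 1 / 4"
    using weight_deg5_deg5[OF uvw deg_u deg_v] weight_deg5_deg5[OF swapped(1) deg_v deg_u] False
    unfolding swapped(2) by simp_all
  then show ?thesis using weight_deg8[of w "{u, v, w}"] False by simp
qed

lemma weight_deg5_deg6:
  assumes uvw: "{u, v, w} \<in> T" and deg_u: "deg u = 5" and deg_v: "deg v = 6"
    and deg_w: "deg w \<le> 7"
  shows "weight u {u, v, w} \<ge> 1 / 4" "weight v {u, v, w} \<ge> 2 / 5"
proof -
  note tri = T_triangleD[OF uvw]
  note at = in_triangles_at[OF uvw]
  have "codeg u v \<le> 1"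
    using codeg_le_1_if_common_nbrs[OF deg5_deg6_common_nbrs[OF uvw deg_u deg_v deg_w]] tri
    by simp
  then have few: "card (triangles_at u) \<le> 4" "card (triangles_at v) \<le> 5"
    using card_triangles_at_less[of v u] card_triangles_at_less[of u v] codeg_commute[of u v]
      tri deg_u deg_v
    by auto
  have "needy u {u, v, w}" using deg_v tri by (auto simp: needy_def)
  then show "weight u {u, v, w} \<ge> 1 / 4"
    using weight_deg5_ge[of "{u, v, w}" u 4] at deg_u few(1) num_needy_le[of u] by simp
  show "weight v {u, v, w} \<ge> 2 / 5"
    using weight_deg6_few_triangles_ge[OF at(2) low_triangleI[OF uvw] deg_v few(2)] deg_u by simp
qed

lemma triangle_weight_deg5_deg6:
  assumes uvw: "{u, v, w} \<in> T" and deg_u: "deg u = 5" and deg_v: "deg v = 6"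
    and deg_w: "6 \<le> deg w"
  shows "weight u {u, v, w} + weight v {u, v, w} + weight w {u, v, w} \<ge> 1"
proof -
  note at = in_triangles_at[OF uvw]
  have swapped: "{u, w, v} \<in> T" "{u, w, v} = {u, v, w}" using uvw by (auto simp: insert_commute)
  consider "deg w = 6" | "deg w = 7" | "8 \<le> deg w" using deg_w by linarith
  then show ?thesis
  proof cases
    case 1
    then show ?thesis
      using weight_deg5_deg6[OF uvw deg_u deg_v] weight_deg5_deg6(2)[OF swapped(1) deg_u] deg_v
      unfolding swapped(2)
      by simp
  next
    case 2
    then show ?thesis
      using weight_deg5_deg6[OF uvw deg_u deg_v] weight_deg7_ge[OF at(3) low_triangleI[OF uvw]]
        deg_u by simp
  next
    case 3
    have "needy u {u, v, w}" using deg_v T_triangleD[OF uvw] by (auto simp: needy_def)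
    then have "weight u {u, v, w} \<ge> 1 / 5"
      using weight_deg5_ge[of "{u, v, w}" u 5] at deg_u num_needy_le[of u]
        card_triangles_at_le[of u] by simp
    then show ?thesis
      using weight_ge_third[OF at(2)] weight_deg8[of w "{u, v, w}"] deg_v 3 by simp
  qed
qed

lemma triangle_weight_deg5_deg7:
  assumes uvw: "{u, v, w} \<in> T" and deg_u: "deg u = 5" and deg_v: "7 \<le> deg v"
    and deg_w: "7 \<le> deg w"
  shows "weight u {u, v, w} + weight v {u, v, w} + weight w {u, v, w} \<ge> 1"
proof -
  note at = in_triangles_at[OF uvw]
  have low: "low {u, v, w}" using low_triangleI[OF uvw] deg_u by simp
  have heavy: "weight x {u, v, w} \<ge> 3 / 7" if "{u, v, w} \<in> triangles_at x" "7 \<le> deg x" for x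
    using weight_deg7_ge[OF that(1) low] weight_deg8[of x "{u, v, w}"] that(2)
    by (cases "deg x = 7") auto
  show ?thesis
  proof (cases "8 \<le> deg v \<and> 8 \<le> deg w")
    case True
    then show ?thesis
      using weight_deg8[of v "{u, v, w}"] weight_deg8[of w "{u, v, w}"] weight_nonneg[OF at(1)]
      by simp
  next
    case False
    then have "needy u {u, v, w}" using T_triangleD[OF uvw] by (auto simp: needy_def)
    then have "weight u {u, v, w} \<ge> 1 / 5"
      using weight_deg5_ge[of "{u, v, w}" u 5] at deg_u num_needy_le[of u]
        card_triangles_at_le[of u] by simp
    then show ?thesis using heavy[OF at(2) deg_v] heavy[OF at(3) deg_w] by simp
  qed
qed

lemma triangle_weight_sorted:
  assumes uvw: "{u, v, w} \<in> T" and sorted: "4 \<le> deg u" "deg u \<le> deg v" "deg v \<le> deg w"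
  shows "weight u {u, v, w} + weight v {u, v, w} + weight w {u, v, w} \<ge> 1"
proof -
  consider "deg u = 4" | "deg u = 5" "deg v = 5" | "deg u = 5" "deg v = 6" | "deg u = 5" "7 \<le> deg v"
    | "6 \<le> deg u" using sorted by linarith
  then show ?thesis
  proof cases
    case 1
    then show ?thesis using uvw sorted(3) by (intro triangle_weight_deg4)
  next
    case 2
    then show ?thesis by (rule triangle_weight_deg5_deg5[OF uvw])
  next
    case 3
    then show ?thesis using uvw sorted(3) by (intro triangle_weight_deg5_deg6) auto
  next
    case 4
    then show ?thesis using uvw sorted(3) by (intro triangle_weight_deg5_deg7) auto
  next
    case 5
    note at = in_triangles_at[OF uvw]
    show ?thesis
      using weight_ge_third[OF at(1)] weight_ge_third[OF at(2)] weight_ge_third[OF at(3)] 5 sorted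
      by linarith
  qed
qed

lemma triangle_weight:
  assumes t_in_T: "t \<in> T" and deg_ge: "\<And>x. x \<in> t \<Longrightarrow> 4 \<le> deg x"
  shows "(\<Sum>x \<in> t. weight x t) \<ge> 1"
proof -
  have "t \<noteq> {}" using T_triangles[OF t_in_T] by (auto simp: triangles_def)
  then obtain x y z where xyz: "t = {x, y, z}"
    using triangle_through_vertex[OF T_triangles[OF t_in_T]] by blast
  obtain u v w where uvw: "{x, y, z} = {u, v, w}" and sorted: "deg u \<le> deg v" "deg v \<le> deg w"
    using sort_three[of x y z deg] by blast
  have uvw_in_T: "{u, v, w} \<in> T" using t_in_T xyz uvw by simp
  have "weight u {u, v, w} + weight v {u, v, w} + weight w {u, v, w} \<ge> 1"
    using triangle_weight_sorted[OF uvw_in_T _ sorted] deg_ge xyz uvw by auto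
  then show ?thesis using T_triangleD(1-3)[OF uvw_in_T] unfolding xyz uvw by simp
qed

definition small_vertices :: "'a set" where
  "small_vertices = {x \<in> V. deg x \<le> 3}"

lemma small_vertices_subset: "small_vertices \<subseteq> V"
  by (auto simp: small_vertices_def)

lemma finite_small_vertices [simp]: "finite small_vertices"
  using small_vertices_subset finite_V by (rule finite_subset)

lemma card_T_le_sum_weight:
  "real (card T) \<le> (\<Sum>x \<in> V - small_vertices. \<Sum>t \<in> triangles_at x. weight x t)
     + real (card {t \<in> T. t \<inter> small_vertices \<noteq> {}})"
proof -
  have collected: "(\<Sum>x \<in> {x \<in> V - small_vertices. x \<in> t}. weight x t)
      \<ge> (if t \<inter> small_vertices = {} then 1 else 0)" if t_in_T: "t \<in> T" for t
  proof (cases "t \<inter> small_vertices = {}")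
    case True
    then have "{x \<in> V - small_vertices. x \<in> t} = t" "\<And>x. x \<in> t \<Longrightarrow> 4 \<le> deg x"
      using T_subset_V[OF t_in_T] by (auto simp: small_vertices_def)
    then show ?thesis using triangle_weight[OF t_in_T] True by simp
  next
    case False
    have "0 \<le> (\<Sum>x \<in> {x \<in> V - small_vertices. x \<in> t}. weight x t)"
      using t_in_T by (intro sum_nonneg weight_nonneg) (simp add: triangles_at_def)
    then show ?thesis using False by simp
  qed
  have "card T = card ({t \<in> T. t \<inter> small_vertices = {}} \<union> {t \<in> T. t \<inter> small_vertices \<noteq> {}})"
    by (rule arg_cong[of _ _ card]) blast
  also have "\<dots> = card {t \<in> T. t \<inter> small_vertices = {}} + card {t \<in> T. t \<inter> small_vertices \<noteq> {}}"
    using finite_T by (intro card_Un_disjoint) auto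
  finally have split: "real (card T) = real (card {t \<in> T. t \<inter> small_vertices = {}})
      + real (card {t \<in> T. t \<inter> small_vertices \<noteq> {}})" by simp
  have "real (card {t \<in> T. t \<inter> small_vertices = {}})
      = (\<Sum>t \<in> T. if t \<inter> small_vertices = {} then 1 else 0)"
    unfolding sum.inter_filter[OF finite_T, symmetric] by simp
  also have "\<dots> \<le> (\<Sum>t \<in> T. \<Sum>x \<in> {x \<in> V - small_vertices. x \<in> t}. weight x t)"
    by (intro sum_mono collected)
  also have "\<dots> = (\<Sum>x \<in> V - small_vertices. \<Sum>t \<in> triangles_at x. weight x t)"
    unfolding triangles_at_def
    by (rule sum.swap_restrict[symmetric]) (use finite_V finite_T in auto)
  finally show ?thesis using split by linarith
qed

lemma sum_charge:
  "2 * real (card E) - 4 * real (card V)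
     = (\<Sum>x \<in> V - small_vertices. real (deg x) - 4) + (\<Sum>x \<in> small_vertices. real (deg x) - 4)"
proof -
  have "2 * real (card E) - 4 * real (card V) = (\<Sum>x \<in> V. real (deg x) - 4)"
    using sum_deg by (simp add: sum_subtractf flip: of_nat_sum)
  also have "\<dots> = (\<Sum>x \<in> V - small_vertices. real (deg x) - 4)
      + (\<Sum>x \<in> small_vertices. real (deg x) - 4)"
    using small_vertices_subset finite_V by (intro sum.subset_diff)
  finally show ?thesis .
qed

lemma few_triangles_if_few_small:
  assumes "card small_vertices \<le> 1"
  shows "card T + 4 * card V < 2 * card E + 6"
proof -
  have "(\<Sum>x \<in> V - small_vertices. \<Sum>t \<in> triangles_at x. weight x t)
      \<le> (\<Sum>x \<in> V - small_vertices. real (deg x) - 4)"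
    using sum_weight_le[of _ "{}"] by (intro sum_mono) (auto simp: small_vertices_def)
  moreover have "real (card {t \<in> T. t \<inter> small_vertices \<noteq> {}})
      \<le> (\<Sum>x \<in> small_vertices. real (deg x) - 4) + 4"
  proof (cases "small_vertices = {}")
    case False
    then obtain u where small_eq: "small_vertices = {u}"
      using assms by
        (metis card_1_singletonE card_0_eq finite_small_vertices le_antisym less_one not_le)
    then have "{t \<in> T. t \<inter> small_vertices \<noteq> {}} = triangles_at u" by (auto simp: triangles_at_def)
    then show ?thesis using small_eq card_triangles_at_le[of u] by simp
  qed simp
  ultimately have "real (card T) \<le> 2 * real (card E) - 4 * real (card V) + 4"
    using card_T_le_sum_weight sum_charge by linarith
  then show ?thesis by linarith
qed

lemma two_small_vertices:
  assumes two: "\<not> card small_vertices \<le> 1" and u_small: "u \<in> small_vertices"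
  shows "deg u = 3" "triangles_at u = {}" "\<And>b. b \<in> nbr u \<Longrightarrow> deg b = 2 * k - 1"
proof -
  have "\<not> small_vertices \<subseteq> {u}" using two card_mono[of "{u}" small_vertices] by auto
  then obtain v where "v \<in> small_vertices" "u \<noteq> v" by auto
  then have "u \<in> V" "v \<in> V" "deg u \<le> 3" "deg v \<le> 3"
    using u_small by (auto simp: small_vertices_def)
  note two_deg3[OF this(1,2) \<open>u \<noteq> v\<close> this(3,4)]
  then show "deg u = 3" "triangles_at u = {}" "\<And>b. b \<in> nbr u \<Longrightarrow> deg b = 2 * k - 1" by blast+
qed

lemma few_triangles_if_two_small:
  assumes two: "\<not> card small_vertices \<le> 1"
  shows "card T + 4 * card V < 2 * card E + 6"
proof -
  note small = two_small_vertices[OF two]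
  have no_triangle: "{t \<in> T. t \<inter> small_vertices \<noteq> {}} = {}"
    using small(2) by (auto simp: triangles_at_def)
  have budget: "(\<Sum>t \<in> triangles_at x. weight x t) + real (card (nbr x \<inter> small_vertices)) / 2
      \<le> real (deg x) - 4" if x: "x \<in> V - small_vertices" for x
  proof (rule sum_weight_le)
    show "4 \<le> deg x" using x by (auto simp: small_vertices_def)
    show "codeg x y = 0" if y: "y \<in> nbr x \<inter> small_vertices" for y
    proof -
      have "{t \<in> T. {x, y} \<subseteq> t} \<subseteq> triangles_at y" by (auto simp: triangles_at_def)
      then have "{t \<in> T. {x, y} \<subseteq> t} = {}" using small(2)[of y] y by auto
      then show ?thesis by (metis card.empty)
    qed
    show "8 \<le> deg x \<or> nbr x \<inter> small_vertices = {}"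
      using small(3)[of _ x] neighbours_sym[of _ E x] k_bounds by fastforce
  qed auto
  have "nbr y - small_vertices = nbr y" if "y \<in> small_vertices" for y
    using small(3)[OF that] k_bounds by (auto simp: small_vertices_def)
  then have "(\<Sum>y \<in> small_vertices. card (nbr y - small_vertices)) = 3 * card small_vertices"
    using small(1) by simp
  then have "(\<Sum>x \<in> V - small_vertices. card (nbr x \<inter> small_vertices)) = 3 * card small_vertices"
    using sum_card_nbr_Int[OF small_vertices_subset] by simp
  then have "(\<Sum>x \<in> V - small_vertices. real (card (nbr x \<inter> small_vertices)) / 2)
      = 3 * real (card small_vertices) / 2"
    by (simp flip: sum_divide_distrib of_nat_sum)
  moreover have "(\<Sum>x \<in> V - small_vertices. (\<Sum>t \<in> triangles_at x. weight x t)
      + real (card (nbr x \<inter> small_vertices)) / 2) \<le> (\<Sum>x \<in> V - small_vertices. real (deg x) - 4)"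
    by (intro sum_mono budget)
  moreover have "(\<Sum>x \<in> small_vertices. real (deg x) - 4) = - real (card small_vertices)"
    using small(1) by simp
  ultimately have "real (card T) \<le> 2 * real (card E) - 4 * real (card V)"
    using card_T_le_sum_weight sum_charge no_triangle by (simp add: sum.distrib)
  then show ?thesis by linarith
qed

lemma few_triangles: "card T + 4 * card V < 2 * card E + 6"
  using few_triangles_if_few_small few_triangles_if_two_small by blast

end

theorem (in plane_graph) ex_reducible_list:
  assumes k_bounds: "5 \<le> k" "k \<le> card V" and max_deg: "\<And>x. x \<in> V \<Longrightarrow> deg x \<le> 2 * k - 1"
  obtains xs where "length xs = k" "reducible_list E V xs"
proof (rule ccontr)
  assume irreducible: "\<not> thesis"
  obtain T where T_packing: "triangle_packing E {} T" "2 * card E + 6 \<le> card T + 4 * card V"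
    using plane_graph_bound k_bounds by (auto simp: triangle_bound_def)
  interpret irreducible_graph V E T k
    by unfold_locales (use T_packing(1) k_bounds max_deg degenerate_5 irreducible that in auto)
  show False using few_triangles T_packing(2) by simp
qed

section \<open>Equitable list colouring\<close>

lemma card_rare_colours_ge:
  assumes "finite A" "finite C" "card A \<le> 2 * i + 1"
  shows "card C - i \<le> card {\<alpha> \<in> C. card {y \<in> A. c y = \<alpha>} \<le> 1}"
proof -
  define repeated where "repeated = {\<alpha> \<in> C. \<not> card {y \<in> A. c y = \<alpha>} \<le> 1}"
  have finite_repeated: "finite repeated" using assms(2) by (simp add: repeated_def)
  have "(\<Sum>\<alpha> \<in> repeated. 2) \<le> (\<Sum>\<alpha> \<in> repeated. card {y \<in> A. c y = \<alpha>})"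
    by (intro sum_mono) (auto simp: repeated_def)
  also have "\<dots> = card (\<Union>\<alpha> \<in> repeated. {y \<in> A. c y = \<alpha>})"
    using assms(1) finite_repeated by (subst card_UN_disjoint) auto
  also have "\<dots> \<le> card A" using assms(1) by (intro card_mono) auto
  finally have "card repeated \<le> i" using assms(3) by simp
  moreover have "card C - card repeated \<le> card (C - repeated)"
    using finite_repeated by (rule diff_card_le_card_Diff)
  moreover have "C - repeated = {\<alpha> \<in> C. card {y \<in> A. c y = \<alpha>} \<le> 1}"
    by (auto simp: repeated_def)
  ultimately show ?thesis by simp
qed

lemma greedy_distinct_representatives:
  assumes "distinct xs" "\<And>i. i < length xs \<Longrightarrow> length xs - i \<le> card (C (xs ! i))"
  shows "\<exists>d. inj_on d (set xs) \<and> (\<forall>x \<in> set xs. d x \<in> C x)"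
  using assms
proof (induction xs)
  case (Cons x xs)
  have "length xs - i \<le> card (C (xs ! i))" if "i < length xs" for i
    using Cons.prems(2)[of "Suc i"] that by simp
  then obtain d where d_distinct: "inj_on d (set xs)" "\<forall>y \<in> set xs. d y \<in> C y"
    using Cons by auto
  have "card (d ` set xs) \<le> length xs"
    using card_image_le[of "set xs" d] card_length[of xs] by simp
  also have "\<dots> < card (C x)" using Cons.prems(2)[of 0] by simp
  finally have "\<not> C x \<subseteq> d ` set xs" using card_mono[of "d ` set xs" "C x"] by auto
  then obtain \<alpha> where fresh: "\<alpha> \<in> C x" "\<alpha> \<notin> d ` set xs" by blast
  have "inj_on (d(x := \<alpha>)) (set (x # xs)) \<and> (\<forall>y \<in> set (x # xs). (d(x := \<alpha>)) y \<in> C y)"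
    using d_distinct fresh Cons.prems(1) by (auto simp: inj_on_def)
  then show ?case by blast
qed simp

lemma reducible_list_colouring:
  assumes reducible: "reducible_list E W xs" "length xs \<le> k" and "finite W"
    and lists: "\<And>v. v \<in> set xs \<Longrightarrow> finite (L v) \<and> card (L v) = k"
  shows "\<exists>d. inj_on d (set xs) \<and> (\<forall>v \<in> set xs. d v \<in> L v \<and>
    card {y \<in> neighbours E v \<inter> W - set xs. c y = d v} \<le> 1)"
proof -
  define rare where
    "rare v = {\<alpha> \<in> L v. card {y \<in> neighbours E v \<inter> W - set xs. c y = \<alpha>} \<le> 1}" for v
  have "length xs - i \<le> card (rare (xs ! i))" if i: "i < length xs" for i
  proof -
    have "card (L (xs ! i)) - i \<le> card (rare (xs ! i))"
      unfolding rare_def using reducible(1) lists[of "xs ! i"] i \<open>finite W\<close>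
      by (intro card_rare_colours_ge) (auto simp: reducible_list_def)
    then show ?thesis using lists[of "xs ! i"] i reducible(2) by simp
  qed
  moreover have "distinct xs" using reducible(1) by (simp add: reducible_list_def)
  ultimately obtain d where "inj_on d (set xs)" "\<forall>v \<in> set xs. d v \<in> rare v"
    using greedy_distinct_representatives[of xs rare] by blast
  then show ?thesis by (auto simp: rare_def)
qed

text \<open>
  The cardinality bound says that the class of \<open>x\<close> has at most \<open>\<lceil>|W| / k\<rceil>\<close> vertices. Being
  1-degenerate is a form of acyclicity that is trivially kept when a vertex with at most one
  neighbour is added.
\<close>

definition equitable_forest_colouring ::
    "'a set set \<Rightarrow> nat \<Rightarrow> ('a \<Rightarrow> 'c set) \<Rightarrow> 'a set \<Rightarrow> ('a \<Rightarrow> 'c) \<Rightarrow> bool" where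
  "equitable_forest_colouring E k L W c \<longleftrightarrow> (\<forall>v \<in> W. c v \<in> L v) \<and>
     (\<forall>x. degenerate E 1 {v \<in> W. c v = x} \<and> card {v \<in> W. c v = x} * k < card W + k)"

lemma (in simple_graph) insert_into_colour_class:
  assumes finite_W: "finite W" and xs: "distinct xs" "set xs \<subseteq> W" "length xs = k \<or> set xs = W"
    and Y: "Y \<subseteq> W - set xs" "degenerate E 1 Y" "card Y * k < card (W - set xs) + k"
    and v: "v \<in> set xs" "card (nbr v \<inter> Y) \<le> 1"
  shows "degenerate E 1 (insert v Y) \<and> card (insert v Y) * k < card W + k"
proof
  have finite_Y: "finite Y" using Y(1) finite_W finite_subset by blast
  show "degenerate E 1 (insert v Y)" using v(2) Y(2) finite_Y by (rule degenerate_insert)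
  have "card W = card (W - set xs) + length xs"
    using card_Diff_subset[of "set xs" W] card_mono[OF finite_W xs(2)] xs(1,2)
    by (simp add: distinct_card)
  moreover have "0 < length xs" using v(1) by (cases xs) auto
  moreover have "length xs = k \<or> card (W - set xs) = 0" using xs(3) by auto
  moreover have "card (insert v Y) = Suc (card Y)"
    using v(1) Y(1) finite_Y by (intro card_insert_disjoint) auto
  ultimately show "card (insert v Y) * k < card W + k" using Y(3) by auto
qed

lemma (in simple_graph) extend_equitable_forest_colouring:
  assumes W_subset: "W \<subseteq> V"
    and reducible: "reducible_list E W xs" "length xs \<le> k" "length xs = k \<or> set xs = W"
    and lists: "\<And>v. v \<in> W \<Longrightarrow> finite (L v) \<and> card (L v) = k"
    and colouring: "equitable_forest_colouring E k L (W - set xs) c"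
  shows "\<exists>c. equitable_forest_colouring E k L W c"
proof -
  have finite_W: "finite W" using W_subset finite_V by (rule finite_subset)
  have xs_W: "distinct xs" "set xs \<subseteq> W" using reducible(1) by (simp_all add: reducible_list_def)
  obtain d where d_choice: "inj_on d (set xs)" "\<forall>v \<in> set xs. d v \<in> L v"
    and rare: "\<forall>v \<in> set xs. card {y \<in> nbr v \<inter> W - set xs. c y = d v} \<le> 1"
    using reducible_list_colouring[OF reducible(1,2) finite_W, of L c] lists xs_W(2) by blast
  define e where "e v = (if v \<in> set xs then d v else c v)" for v
  have "degenerate E 1 {v \<in> W. e v = x} \<and> card {v \<in> W. e v = x} * k < card W + k" for x
  proof -
    define Y where "Y = {v \<in> W - set xs. c v = x}"
    have Y_class: "Y \<subseteq> W - set xs" "degenerate E 1 Y" "card Y * k < card (W - set xs) + k"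
      using colouring by (auto simp: equitable_forest_colouring_def Y_def)
    show ?thesis
    proof (cases "x \<in> d ` set xs")
      case False
      then have "{v \<in> W. e v = x} = Y" by (auto simp: e_def Y_def)
      moreover have "card (W - set xs) \<le> card W" using finite_W by (intro card_mono) auto
      ultimately show ?thesis using Y_class by simp
    next
      case True
      then obtain v where v_colour: "v \<in> set xs" "d v = x" by auto
      have "{w \<in> W. e w = x} = {w \<in> set xs. d w = x} \<union> Y"
        using xs_W(2) by (auto simp: e_def Y_def)
      also have "{w \<in> set xs. d w = x} = {v}"
        using v_colour d_choice(1) by (auto simp: inj_on_def)
      finally have class_eq: "{w \<in> W. e w = x} = insert v Y" by simp
      have "{y \<in> nbr v \<inter> W - set xs. c y = d v} = nbr v \<inter> Y" using v_colour by (auto simp: Y_def)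
      then have "card (nbr v \<inter> Y) \<le> 1" using rare v_colour(1) by metis
      then show ?thesis
        unfolding class_eq
        by (rule insert_into_colour_class[OF finite_W xs_W reducible(3) Y_class v_colour(1)])
    qed
  qed
  moreover have "\<forall>v \<in> W. e v \<in> L v"
    using colouring d_choice(2) by (auto simp: e_def equitable_forest_colouring_def)
  ultimately show ?thesis unfolding equitable_forest_colouring_def by blast
qed

theorem (in simple_graph) ex_equitable_forest_colouring:
  assumes reducible: "\<And>W. W \<subseteq> V \<Longrightarrow> k \<le> card W \<Longrightarrow> \<exists>xs. length xs = k \<and> reducible_list E W xs"
    and "0 < k" and lists: "\<And>v. v \<in> V \<Longrightarrow> finite (L v) \<and> card (L v) = k"
    and "W \<subseteq> V"
  shows "\<exists>c. equitable_forest_colouring E k L W c"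
  using \<open>W \<subseteq> V\<close>
proof (induction "card W" arbitrary: W rule: less_induct)
  case less
  have finite_W: "finite W" using less.prems finite_V by (rule finite_subset)
  show ?case
  proof (cases "W = {}")
    case True
    then have "equitable_forest_colouring E k L W c" for c
      using \<open>0 < k\<close> by (simp add: equitable_forest_colouring_def degenerate_def)
    then show ?thesis by blast
  next
    case False
    obtain xs where xs: "reducible_list E W xs" "length xs \<le> k" "length xs = k \<or> set xs = W"
    proof (cases "k \<le> card W")
      case True
      then show ?thesis using reducible[OF less.prems] that by auto
    next
      case False
      obtain xs where xs: "set xs = W" "distinct xs"
        using finite_distinct_list[OF finite_W] by blast
      then have "nbr x \<inter> W - set xs = {}" for x by auto
      then have "card (nbr x \<inter> W - set xs) \<le> n" for x n by (simp only: card.empty le0)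
      then have "reducible_list E W xs" unfolding reducible_list_def using xs by blast
      then show ?thesis using that xs False distinct_card[OF xs(2)] by auto
    qed
    have "xs \<noteq> []" using xs(3) \<open>0 < k\<close> False by auto
    moreover have "set xs \<subseteq> W" using xs(1) by (simp add: reducible_list_def)
    ultimately have "W - set xs \<subset> W" by (cases xs) auto
    then have "card (W - set xs) < card W" using finite_W by (intro psubset_card_mono)
    then obtain c where "equitable_forest_colouring E k L (W - set xs) c"
      using less.hyps[of "W - set xs"] less.prems by blast
    then show ?thesis
      using less.prems lists by (intro extend_equitable_forest_colouring[OF less.prems xs]) auto
  qed
qed

theorem (in plane_graph) plane_graph_equitable_forest_colouring:
  assumes "5 \<le> k" and max_deg: "\<And>x. x \<in> V \<Longrightarrow> deg x \<le> 2 * k - 1"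
    and lists: "\<And>v. v \<in> V \<Longrightarrow> finite (L v) \<and> card (L v) = k"
  shows "\<exists>c. equitable_forest_colouring E k L V c"
proof (rule ex_equitable_forest_colouring)
  fix W assume W: "W \<subseteq> V" "k \<le> card W"
  interpret W: plane_graph W "induced_edges E W" \<phi> \<gamma> by (rule plane_graph_induced[OF W(1)])
  have "W.deg x \<le> 2 * k - 1" if "x \<in> W" for x
  proof -
    have "W.deg x \<le> deg x" unfolding neighbours_induced_edges[OF that] by (intro card_mono) auto
    then show ?thesis using max_deg[of x] that W(1) by fastforce
  qed
  then obtain xs where "length xs = k" "reducible_list (induced_edges E W) W xs"
    by (rule W.ex_reducible_list[OF \<open>5 \<le> k\<close> W(2)])
  then show "\<exists>xs. length xs = k \<and> reducible_list E W xs"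
    by (auto simp: reducible_list_induced)
qed (use assms in auto)

section \<open>Symmetric digraphs as simple graphs\<close>

lemma (in graph) simple_graph_undirected: "simple_graph (verts G) (undirected_edges G)"
proof
  fix e assume "e \<in> undirected_edges G"
  then obtain u v where e_eq: "e = {u, v}" "u \<rightarrow>\<^bsub>G\<^esub> v" by (auto simp: undirected_edges_def)
  then have "u \<in> verts G" "v \<in> verts G" "u \<noteq> v"
    using no_loops by (auto simp: arcs_ends_conv)
  then show "e \<subseteq> verts G \<and> card e = 2" using e_eq by auto
qed simp

lemma (in graph) plane_graph_if_plane_drawing:
  assumes "plane_drawing G \<phi> \<gamma>"
  shows "plane_graph (verts G) (undirected_edges G) \<phi> \<gamma>"
proof -
  interpret simple_graph "verts G" "undirected_edges G" by (rule simple_graph_undirected)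
  show ?thesis by unfold_locales (use assms in \<open>auto simp: plane_drawing_def\<close>)
qed

lemma (in graph) neighbours_undirected: "neighbours (undirected_edges G) x = {y. x \<rightarrow>\<^bsub>G\<^esub> y}"
  using arcs_ends_symmetric[OF sym_arcs]
  by (auto simp: neighbours_def undirected_edges_def doubleton_eq_iff)

lemma (in graph) card_neighbours_undirected:
  "card (neighbours (undirected_edges G) x) = out_degree G x"
proof -
  have "inj_on (head G) (out_arcs G x)"
    by (auto simp: inj_on_def arc_to_ends_def intro: no_multi_arcs)
  moreover have "head G ` out_arcs G x = {y. x \<rightarrow>\<^bsub>G\<^esub> y}"
    by (auto simp: arcs_ends_conv)
  ultimately show ?thesis
    unfolding neighbours_undirected out_degree_def by (metis card_image)
qed

lemma (in graph) out_degree_le_max_degree: "x \<in> verts G \<Longrightarrow> out_degree G x \<le> max_degree G"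
  by (simp add: max_degree_def)

lemma (in wf_digraph) walk_edges_awalk_verts:
  assumes "cas u p v" "set p \<subseteq> arcs G"
  shows "walk_edges (awalk_verts u p) \<subseteq> undirected_edges G"
  using assms
proof (induction p arbitrary: u)
  case (Cons e p)
  have "hd (awalk_verts (head G e) p) = head G e" using Cons.prems(1) by (auto intro: awhd_if_cas)
  then obtain ws where ws: "awalk_verts (head G e) p = head G e # ws"
    by (metis awalk_verts_non_Nil list.collapse)
  have "{tail G e, head G e} \<in> undirected_edges G"
    using Cons.prems(2) by (auto simp: undirected_edges_def arcs_ends_conv)
  moreover have "walk_edges (awalk_verts (head G e) p) \<subseteq> undirected_edges G"
    using Cons.prems by (intro Cons.IH) auto
  ultimately show ?case using ws by simp
qed simp

lemma (in wf_digraph) is_cycle_if_cycle: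
  assumes "cycle p" "3 \<le> length p"
  obtains cs where "is_cycle (undirected_edges G) cs"
proof -
  obtain u where u_walk: "cas u p u" "set p \<subseteq> arcs G" "distinct (tl (awalk_verts u p))" "p \<noteq> []"
    using assms(1) by (auto simp: cycle_def awalk_def)
  have ends: "hd (awalk_verts u p) = u" "last (awalk_verts u p) = u"
    using awhd_if_cas[OF u_walk(1)] awlast_if_cas[OF u_walk(1)] .
  define cs where "cs = tl (awalk_verts u p)"
  have verts: "awalk_verts u p = u # cs"
    unfolding cs_def using ends(1) by (metis awalk_verts_non_Nil list.collapse)
  have len: "length cs = length p" using length_awalk_verts[of u p] verts by simp
  then have "cs \<noteq> []" using u_walk(4) by auto
  then have snoc: "cs = butlast cs @ [u]"
    using ends(2) verts by (metis append_butlast_last_id last_ConsR)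
  have "cycle_edges cs = cycle_edges (u # butlast cs)"
    using cycle_edges_append_commute[of "butlast cs" "[u]"] snoc by simp
  also have "\<dots> = walk_edges (awalk_verts u p)"
    unfolding verts using snoc by (simp add: cycle_edges_def)
  also have "\<dots> \<subseteq> undirected_edges G" by (rule walk_edges_awalk_verts[OF u_walk(1,2)])
  finally have "is_cycle (undirected_edges G) cs"
    using u_walk(3) assms(2) len by (simp add: is_cycle_def cs_def)
  then show ?thesis by (rule that)
qed

lemma undirected_edges_induce_subgraph:
  "undirected_edges (G \<restriction> X) \<subseteq> induced_edges (undirected_edges G) X"
  by (auto simp: undirected_edges_def induced_edges_def arcs_ends_conv)

lemma (in graph) undirected_acyclic_if_degenerate_1:
  assumes X_subset: "X \<subseteq> verts G" and degenerate: "degenerate (undirected_edges G) 1 X"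
  shows "undirected_acyclic (G \<restriction> X)"
  unfolding undirected_acyclic_def
proof
  interpret simple_graph "verts G" "undirected_edges G" by (rule simple_graph_undirected)
  assume "\<exists>p. pre_digraph.cycle (G \<restriction> X) p \<and> 3 \<le> length p"
  then obtain cs where "is_cycle (undirected_edges (G \<restriction> X)) cs"
    using wf_digraph.is_cycle_if_cycle[OF wellformed_induce_subgraph] by blast
  then have "is_cycle (induced_edges (undirected_edges G) X) cs"
    using undirected_edges_induce_subgraph[of G X] by (auto simp: is_cycle_def)
  then show False using no_cycle_if_degenerate_1[OF X_subset degenerate] by blast
qed

lemma le_ceiling_divide:
  fixes m n k :: nat
  assumes "m * k < n + k" "0 < k"
  shows "int m \<le> \<lceil>real n / real k\<rceil>"
proof -
  have "real (m * k) < real (n + k)" using assms(1) by (simp only: of_nat_less_iff)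
  then have "of_int (int m - 1) < real n / real k" using assms(2) by (simp add: field_simps)
  then have "int m - 1 < \<lceil>real n / real k\<rceil>" by (simp only: less_ceiling_iff)
  then show ?thesis by simp
qed

lemma ceiling_half_Suc_le_iff: "\<lceil>(real n + 1) / 2\<rceil> \<le> int k \<longleftrightarrow> n + 1 \<le> 2 * k"
proof -
  have "\<lceil>(real n + 1) / 2\<rceil> \<le> int k \<longleftrightarrow> real (n + 1) \<le> real (2 * k)"
    by (simp add: ceiling_le_iff field_simps)
  then show ?thesis by (simp only: of_nat_le_iff)
qed

theorem theorem4:
  fixes G :: "('a, 'b) pre_digraph" and k :: nat
  assumes "graph G"
    and "planar_graph G"
    and "int k \<ge> max \<lceil>(real (max_degree G) + 1) / 2\<rceil> 5"
  shows "equitable_list_point_arborable TYPE('c) G k"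
  unfolding equitable_list_point_arborable_def
proof (intro allI impI)
  fix L :: "'a \<Rightarrow> 'c set" assume lists: "list_assignment G k L"
  interpret graph G by fact
  obtain \<phi> \<gamma> where "plane_drawing G \<phi> \<gamma>" using assms(2) by (auto simp: planar_graph_def)
  then interpret plane_graph "verts G" "undirected_edges G" \<phi> \<gamma>
    by (rule plane_graph_if_plane_drawing)
  have k_bounds: "5 \<le> k" "max_degree G + 1 \<le> 2 * k"
    using assms(3) ceiling_half_Suc_le_iff by simp_all
  have "deg x \<le> 2 * k - 1" if "x \<in> verts G" for x
    using out_degree_le_max_degree[OF that] k_bounds(2) by (simp add: card_neighbours_undirected)
  then obtain c where colouring: "equitable_forest_colouring (undirected_edges G) k L (verts G) c"
    using plane_graph_equitable_forest_colouring[OF k_bounds(1)] lists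
    unfolding list_assignment_def by blast
  then have "undirected_acyclic (G \<restriction> {v \<in> verts G. c v = x})"
    "int (card {v \<in> verts G. c v = x}) \<le> \<lceil>real (card (verts G)) / real k\<rceil>" for x
    using k_bounds by (auto simp: equitable_forest_colouring_def
        intro!: undirected_acyclic_if_degenerate_1 le_ceiling_divide)
  then show "\<exists>c. (\<forall>v \<in> verts G. c v \<in> L v) \<and>
      (\<forall>x. undirected_acyclic (G \<restriction> {v \<in> verts G. c v = x}) \<and>
        int (card {v \<in> verts G. c v = x}) \<le> \<lceil>real (card (verts G)) / real k\<rceil>)"
    using colouring by (auto simp: equitable_forest_colouring_def)
qed

end
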